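(* (a) Let $p$ be a prime. Then there exists a cusp form $C_{(1,p)}(z)\in S_4(\Gamma_0(p))$ such that $$(L_p(z))^2=\frac{(p-1)^2}{p^2+1}E_4(z)+\frac{p^2(p-1)^2}{p^2+1}E_4(pz)+C_{(1,p)}(z).$$ (b) Let $p_1,p_2$ be primes such that $p_1\neq p_2$. Then there exist cusp forms $C_{(p_1,p_2)}(z),\ C_{(1,p_1p_2)}(z)\in S_4(\Gamma_0(p_1p_2))$ such that $$\begin{aligned}L_{p_1}(z)L_{p_2}(z)=&\frac{(p_1^2-p_1+1)(p_2^2-p_2+1)}{(p_1^2+1)(p_2^2+1)}E_4(z)-\frac{p_1^3(p_2^2-p_2+1)}{(p_1^2+1)(p_2^2+1)}E_4(p_1z)\\&-\frac{p_2^3(p_1^2-p_1+1)}{(p_1^2+1)(p_2^2+1)}E_4(p_2z)+\frac{p_1^3p_2^3}{(p_1^2+1)(p_2^2+1)}E_4(p_1p_2z)+C_{(p_1,p_2)}(z)\end{aligned}$$ and $$\begin{aligned}(L_{p_1p_2}(z))^2=&\left(1-\frac{2p_1p_2}{(p_1^2+1)(p_2^2+1)}\right)E_4(z)-\frac{2p_1^3p_2}{(p_1^2+1)(p_2^2+1)}E_4(p_1z)\\&-\frac{2p_1p_2^3}{(p_1^2+1)(p_2^2+1)}E_4(p_2z)+\left(p_1^2p_2^2-\frac{2p_1^3p_2^3}{(p_1^2+1)(p_2^2+1)}\right)E_4(p_1p_2z)+C_{(1,p_1p_2)}(z).\end{aligned}$$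
   Context: Here $z$ lies in the upper half plane $\mathbb{H}$ and $q=e^{2\pi i z}$. For $k\in\mathbb{N}_0$ and $n\in\mathbb{N}=\{1,2,3,\dots\}$, $\sigma_k(n)=\sum_{d\mid n}d^k$ (sum over positive divisors), and $\sigma(n)=\sigma_1(n)$. The Eisenstein series are $E_2(z)=1-24\sum_{n\ge1}\sigma(n)q^n$ and $E_4(z)=1+240\sum_{n\ge1}\sigma_3(n)q^n$. For $d\in\mathbb{N}$, $L_d(z)=E_2(z)-d\,E_2(dz)$. $\Gamma_0(N)$ is the group of matrices $\begin{pmatrix}a&b\\c&d\end{pmatrix}$ with $a,b,c,d\in\mathbb{Z}$, $ad-bc=1$, $c\equiv0\pmod N$, and $S_k(\Gamma_0(N))$ is the space of cusp forms of weight $k$ for $\Gamma_0(N)$ (trivial character). *)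

theory Defs
  imports "HOL-Complex_Analysis.Complex_Analysis" "HOL-Computational_Algebra.Primes"
begin

definition upper_half_plane :: "complex set" where
  "upper_half_plane = {z. Im z > 0}"

definition divisor_sigma :: "nat \<Rightarrow> nat \<Rightarrow> nat" where
  "divisor_sigma k n = (\<Sum>d | d dvd n. d ^ k)"

text \<open>The series below are indexed from 0, so the summation index \<open>n\<close> stands for the
  exponent \<open>Suc n\<close> of \<open>q = exp (2 \<pi> i z)\<close>. All functions on the upper half plane are total
  functions on \<open>complex\<close> whose values elsewhere carry no meaning.\<close>

definition E2 :: "complex \<Rightarrow> complex" where
  "E2 z = 1 - 24 * (\<Sum>n. of_nat (divisor_sigma 1 (Suc n)) * exp (2 * of_real pi * \<i> * z) ^ Suc n)"

definition E4 :: "complex \<Rightarrow> complex" where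
  "E4 z = 1 + 240 * (\<Sum>n. of_nat (divisor_sigma 3 (Suc n)) * exp (2 * of_real pi * \<i> * z) ^ Suc n)"

definition L :: "nat \<Rightarrow> complex \<Rightarrow> complex" where
  "L d z = E2 z - of_nat d * E2 (of_nat d * z)"

definition SL2Z :: "(int ^ 2 ^ 2) set" where
  "SL2Z = {\<gamma>. det \<gamma> = 1}"

definition Gamma0 :: "nat \<Rightarrow> (int ^ 2 ^ 2) set" where
  "Gamma0 N = {\<gamma> \<in> SL2Z. int N dvd \<gamma> $ 2 $ 1}"

definition slash :: "nat \<Rightarrow> int ^ 2 ^ 2 \<Rightarrow> (complex \<Rightarrow> complex) \<Rightarrow> complex \<Rightarrow> complex" where
  "slash k \<gamma> f z =
     f ((of_int (\<gamma> $ 1 $ 1) * z + of_int (\<gamma> $ 1 $ 2)) / (of_int (\<gamma> $ 2 $ 1) * z + of_int (\<gamma> $ 2 $ 2)))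
     / (of_int (\<gamma> $ 2 $ 1) * z + of_int (\<gamma> $ 2 $ 2)) ^ k"

definition has_fourier_expansion :: "(complex \<Rightarrow> complex) \<Rightarrow> nat \<Rightarrow> (nat \<Rightarrow> complex) \<Rightarrow> bool" where
  "has_fourier_expansion f N a \<longleftrightarrow>
     (\<forall>z\<in>upper_half_plane. (\<lambda>n. a n * exp (2 * of_real pi * \<i> * z / of_nat N) ^ n) sums f z)"

text \<open>The space of cusp forms of weight \<open>k\<close> for \<open>Gamma0 N\<close>, for \<open>N > 0\<close>. The expansion of
  \<open>f|\<gamma>\<close> for \<open>\<gamma>\<close> in \<open>SL2Z\<close> is the expansion of \<open>f\<close> at the cusp \<open>\<gamma>(\<infinity>)\<close>. The exponential
  \<open>exp (2 \<pi> i z / N)\<close> is a suitable local parameter at every cusp, because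
  \<open>Gamma0 N\<close> contains the principal congruence subgroup of level \<open>N\<close>, which is normal in
  \<open>SL2Z\<close>, so \<open>f|\<gamma>\<close> always has period \<open>N\<close>.\<close>

definition cusp_forms :: "nat \<Rightarrow> nat \<Rightarrow> (complex \<Rightarrow> complex) set" where
  "cusp_forms k N = {f.
     f holomorphic_on upper_half_plane \<and>
     (\<forall>\<gamma>\<in>Gamma0 N. \<forall>z\<in>upper_half_plane. slash k \<gamma> f z = f z) \<and>
     (\<forall>\<gamma>\<in>SL2Z. \<exists>a. has_fourier_expansion (slash k \<gamma> f) N a \<and> a 0 = 0)}"

end

theory Submission
  imports Defs
begin

text \<open>
  The Lipschitz formula, obtained by differentiating the reflection formula of the digamma function,
  identifies \<open>E4\<close> with an absolutely convergent lattice sum, so that its behaviour under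
  \<open>z \<mapsto> -1/z\<close> is visible. For \<open>E2\<close> the double sum is only conditionally convergent: comparing
  \<open>1/(mz+n)\<^sup>2\<close> with the telescoping term \<open>1/(mz+n) - 1/(mz+n+1)\<close> makes the difference absolutely
  summable, and the defect of interchanging the summations is the limit of a cotangent.

  A Euclidean descent on the lower left entry then gives the transformation law under \<open>SL2Z\<close>, and
  writing \<open>diag(\<delta>,1) \<gamma>\<close> as an element of \<open>SL2Z\<close> times an upper triangular matrix shows that at a
  cusp with lower left entry \<open>c\<close> the constant terms of \<open>E4(\<delta>z)\<close> and \<open>L \<delta>\<close> are \<open>(gcd c \<delta> / \<delta>)\<^sup>4\<close>
  and \<open>1 - (gcd c \<delta>)\<^sup>2 / \<delta>\<close>. The coefficients in the theorem are exactly those for which all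
  constant terms cancel.
\<close>

section \<open>The Lipschitz formula\<close>

text \<open>Constant terms of \<open>L\<close> involve squares of gcds, those of \<open>E4\<close>
  fourth powers, and they must match for every lower left entry c. A gcd g of c with a prime p is 1
  or p, and for just these two values g^2 / p = (p + p^3 (g / p)^4) / (p^2 + 1). All coefficients of
  the theorem come from this one relation, applied to p_1 and p_2 separately because gcd(c, p_1 p_2)
  is the product of the two gcds; the denominator p^2 + 1 is (p^4 - 1) / (p^2 - 1).

  The constant term 1 of \<open>E4\<close> corresponds to the row m = 0 of the lattice sum, that is
  to 2 zeta(4). The value of zeta(4) comes out of the same reflection formula: differentiated three
  times and evaluated at 1/2, it gives the sum of the inverse fourth powers of the odd
  numbers.\<close>

definition nome :: "complex \<Rightarrow> complex" where
  "nome z = exp (2 * of_real pi * \<i> * z)"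

lemma norm_nome: "norm (nome z) = exp (- (2 * pi * Im z))"
  by (simp add: nome_def)

lemma norm_nome_less_1: "Im z > 0 \<Longrightarrow> norm (nome z) < 1"
  by (simp add: norm_nome)

lemma Ints_complex_Im: "(z :: complex) \<in> \<int> \<Longrightarrow> Im z = 0"
  by (auto elim: Ints_cases)

lemma nonpos_Ints_if_not_Ints: "(z :: complex) \<notin> \<int> \<Longrightarrow> z \<notin> \<int>\<^sub>\<le>\<^sub>0" "(z :: complex) \<notin> \<int> \<Longrightarrow> 1 - z \<notin> \<int>\<^sub>\<le>\<^sub>0"
  using minus_in_Ints_iff[of z] Ints_diff[of 1 "1 - z"] by (auto dest: nonpos_Ints_Int)

text \<open>Logarithmic differentiation of
  \<open>rGamma z * rGamma (1 - z) = sin (pi z) / pi\<close>. Since \<open>rGamma\<close> is entire,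
  no poles interfere.\<close>

lemma Digamma_reflection:
  assumes "(z :: complex) \<notin> \<int>"
  shows "Digamma (1 - z) - Digamma z = of_real pi * cot (of_real pi * z)"
proof -
  note nz = nonpos_Ints_if_not_Ints[OF assms]
  have "((\<lambda>z. rGamma z * rGamma (1 - z)) has_field_derivative
          rGamma z * rGamma (1 - z) * (Digamma (1 - z) - Digamma z)) (at z)"
    using nz by (auto intro!: derivative_eq_intros simp: algebra_simps)
  moreover have "((\<lambda>z. rGamma z * rGamma (1 - z)) has_field_derivative cos (of_real pi * z)) (at z)"
    unfolding rGamma_reflection_complex by (auto intro!: derivative_eq_intros)
  ultimately have "rGamma z * rGamma (1 - z) * (Digamma (1 - z) - Digamma z) = cos (of_real pi * z)"
    by (rule DERIV_unique)
  moreover have "rGamma z * rGamma (1 - z) \<noteq> 0"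
    using nz by (auto simp: rGamma_eq_zero_iff)
  ultimately show ?thesis
    by (auto simp: rGamma_reflection_complex cot_def field_simps)
qed

lemma sin_times_pi_eq_0_complex: "sin (of_real pi * z :: complex) = 0 \<longleftrightarrow> z \<in> \<int>"
  unfolding sin_eq_0 by (auto simp: Ints_def mult.commute)

text \<open>The induction step for two closed forms of the differentiated reflection formula, one
  polynomial in a cotangent and one a power series in the nome. The chain rule for
  \<open>1 - w\<close> contributes the alternating sign; openness of \<open>S\<close> makes the
  formula hold near \<open>z\<close>, so that both sides may be differentiated.\<close>

lemma higher_reflection:
  assumes "\<And>w. w \<in> S \<Longrightarrow> (-1) ^ k * Polygamma k (1 - w) - Polygamma k w = f w"
    and "open S" "S \<inter> \<int> = {}" "z \<in> S" "(f has_field_derivative D) (at z)"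
  shows "(-1) ^ Suc k * Polygamma (Suc k) (1 - z) - Polygamma (Suc k) (z :: complex) = D"
proof -
  have "z \<notin> \<int>" using assms by auto
  note nz = nonpos_Ints_if_not_Ints[OF this]
  have "((\<lambda>w. (-1) ^ k * Polygamma k (1 - w) - Polygamma k w) has_field_derivative
      (-1) ^ Suc k * Polygamma (Suc k) (1 - z) - Polygamma (Suc k) z) (at z)"
    using nz by (auto intro!: derivative_eq_intros has_field_derivative_Polygamma[THEN DERIV_chain2])
  then have "(f has_field_derivative
      (-1) ^ Suc k * Polygamma (Suc k) (1 - z) - Polygamma (Suc k) z) (at z)"
    by (rule has_field_derivative_transform_within_open[OF _ assms(2,4)]) (use assms(1) in auto)
  then show ?thesis
    using assms(5) by (rule DERIV_unique)
qed

text \<open>The point 1/2 is fixed by z -> 1 - z, so at order 3 the left side of the reflection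
  formula is \<open>- 2 * Polygamma 3 (1/2)\<close>. The right side is a polynomial in the
  cotangent, which vanishes there, and only the constant term - 2 pi^4 remains.\<close>

lemma Polygamma_3_one_half: "Polygamma 3 (1 / 2 :: complex) = of_real pi ^ 4"
proof -
  define c where "c w = cot (of_real pi * w :: complex)" for w
  have S: "open (- \<int> :: complex set)" "- \<int> \<inter> \<int> = ({} :: complex set)"
    by (auto simp: open_Compl closed_Ints)
  \<comment> \<open>Writing the derivative of the cotangent as a polynomial in the cotangent keeps
    all later derivatives polynomial.\<close>
  have dc: "(c has_field_derivative - of_real pi * (1 + c w ^ 2)) (at w)" if "w \<in> - \<int>" for w
  proof -
    have s: "sin (of_real pi * w) \<noteq> 0"
      using that by (simp add: sin_times_pi_eq_0_complex)
    have "1 + c w ^ 2 = inverse (sin (of_real pi * w) ^ 2)"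
      using s sin_cos_squared_add[of "of_real pi * w"]
      by (simp add: c_def cot_def power_divide field_simps)
    moreover have "(c has_field_derivative - inverse (sin (of_real pi * w) ^ 2) * of_real pi) (at w)"
      unfolding c_def
      by (rule DERIV_chain2[where f = cot and g = "\<lambda>w. of_real pi * w", OF DERIV_cot[OF s]])
         (auto intro!: derivative_eq_intros)
    ultimately show ?thesis
      by (simp add: mult_ac)
  qed
  note [derivative_intros] = dc[THEN DERIV_chain2]
  have 0: "(-1) ^ 0 * Polygamma 0 (1 - w) - Polygamma 0 w = of_real pi * c w" if "w \<in> - \<int>" for w
    using Digamma_reflection[of w] that by (simp add: c_def)
  have 1: "(-1) ^ Suc 0 * Polygamma (Suc 0) (1 - w) - Polygamma (Suc 0) w = - (of_real pi ^ 2) * (1 + c w ^ 2)"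
    if "w \<in> - \<int>" for w
    by (rule higher_reflection[OF 0 S that])
       (use that in \<open>auto intro!: derivative_eq_intros simp: power2_eq_square\<close>)
  have 2: "(-1) ^ Suc (Suc 0) * Polygamma (Suc (Suc 0)) (1 - w) - Polygamma (Suc (Suc 0)) w
      = 2 * of_real pi ^ 3 * (c w + c w ^ 3)"
    if "w \<in> - \<int>" for w
    by (rule higher_reflection[OF 1 S that])
       (use that in \<open>auto intro!: derivative_eq_intros simp: power2_eq_square power3_eq_cube algebra_simps\<close>)
  have 3: "(-1) ^ Suc (Suc (Suc 0)) * Polygamma (Suc (Suc (Suc 0))) (1 - w) - Polygamma (Suc (Suc (Suc 0))) w
      = - (2 * of_real pi ^ 4) * (1 + c w ^ 2) * (1 + 3 * c w ^ 2)"
    if "w \<in> - \<int>" for w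
    by (rule higher_reflection[OF 2 S that])
       (use that in \<open>auto intro!: derivative_eq_intros simp: eval_nat_numeral algebra_simps\<close>)
  have half: "(1 / 2 :: complex) \<in> - \<int>"
  proof
    assume "(1 / 2 :: complex) \<in> \<int>"
    then obtain n where "(1 / 2 :: complex) = of_int n" by (auto elim: Ints_cases)
    then have "(of_int (2 * n) :: complex) = of_int 1" by (simp add: mult.commute)
    then have "2 * n = 1" by (simp only: of_int_eq_iff)
    then show False by presburger
  qed
  have "c (1 / 2) = 0"
    using cos_of_real[of "pi / 2", where 'a = complex] by (simp add: c_def cot_def)
  with 3[OF half] show ?thesis
    by (simp add: eval_nat_numeral)
qed

text \<open>\<open>Polygamma 3 (1/2)\<close> is 96 times the sum over the odd integers, while the
  even integers contribute 1/16 of the whole series; this gives a linear equation for the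
  sum.\<close>

lemma inverse_fourth_powers_sums: "(\<lambda>n. 1 / real (Suc n) ^ 4) sums (pi ^ 4 / 90)"
proof -
  define f where "f n = 1 / real (Suc n) ^ 4" for n
  have sf: "summable f"
    using inverse_power_summable[of 4, where 'a = real] unfolding f_def
    by (subst summable_Suc_iff) (simp add: divide_inverse)
  have "summable (\<lambda>k. inverse ((1 / 2 + of_nat k :: complex) ^ 4))"
    by (rule Polygamma_converges') auto
  moreover have "Polygamma 3 (1 / 2 :: complex) = 6 * (\<Sum>k. inverse ((1 / 2 + of_nat k) ^ 4))"
    by (simp add: Polygamma_def fact_numeral)
  ultimately have "(\<lambda>k. inverse ((1 / 2 + of_nat k :: complex) ^ 4)) sums (of_real pi ^ 4 / 6)"
    using Polygamma_3_one_half by (simp add: sums_iff field_simps)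
  moreover have "inverse ((1 / 2 + of_nat k :: complex) ^ 4) = of_real (16 * f (2 * k))" for k
  proof -
    have "(1 / 2 + of_nat k :: complex) = of_real (real (Suc (2 * k))) / 2"
      by (simp add: field_simps)
    then show ?thesis
      by (simp only: f_def power_divide) (simp add: field_simps)
  qed
  ultimately have "(\<lambda>k. of_real (16 * f (2 * k)) :: complex) sums of_real (pi ^ 4 / 6)"
    by simp
  \<comment> \<open>\<open>odd\<close> and \<open>even\<close> refer to the integer
    \<open>Suc n\<close> in the denominator, so the odd integers sit at the even indices.\<close>
  then have odd: "(\<lambda>k. f (2 * k)) sums (pi ^ 4 / 96)"
    unfolding sums_of_real_iff using sums_mult[of _ _ "1/16"] by force
  have even: "(\<lambda>k. f (2 * k + 1)) sums (suminf f / 16)"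
  proof -
    have "f (2 * k + 1) = f k / 16" for k
    proof -
      have "real (Suc (2 * k + 1)) = 2 * real (Suc k)" by simp
      then show ?thesis unfolding f_def by (simp only: power_mult_distrib) simp
    qed
    then show ?thesis
      using sums_divide[OF summable_sums[OF sf], of 16] by (simp only:)
  qed
  have "(\<lambda>k. f (2 * k) + f (2 * k + 1)) sums (pi ^ 4 / 96 + suminf f / 16)"
    by (rule sums_add[OF odd even])
  moreover have "(\<lambda>k. f (2 * k) + f (2 * k + 1)) sums suminf f"
    using sums_group[OF summable_sums[OF sf], of 2]
    by (simp add: mult.commute atLeastLessThan_nat_numeral sum.atLeast_Suc_lessThan numeral_2_eq_2)
  ultimately have "suminf f = pi ^ 4 / 96 + suminf f / 16"
    by (rule sums_unique2[symmetric])
  then have "suminf f = pi ^ 4 / 90" by simp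
  then have "f sums (pi ^ 4 / 90)"
    using summable_sums[OF sf] by (simp only:)
  then show ?thesis
    unfolding f_def .
qed

text \<open>The term with \<open>m = 0\<close> is 1 for \<open>k = 0\<close>, because \<open>0 ^ 0 = 1\<close>, and vanishes otherwise.\<close>

definition power_polylog :: "nat \<Rightarrow> complex \<Rightarrow> complex" where
  "power_polylog k x = (\<Sum>m. of_nat m ^ k * x ^ m)"

text \<open>Induction on \<open>k\<close>: termwise differentiation preserves convergence inside the
  disc, and multiplying the result by \<open>r\<close> raises the exponent of \<open>m\<close> by
  one.\<close>

lemma summable_power_times_powser:
  assumes "norm (x :: complex) < 1"
  shows "summable (\<lambda>m. norm (of_nat m ^ k * x ^ m))"
proof -
  have "summable (\<lambda>m. real m ^ k * r ^ m)" if "norm r < 1" for r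
    using that
  proof (induction k arbitrary: r)
    case 0
    then show ?case by simp
  next
    case (Suc k)
    have "summable (\<lambda>m. diffs (\<lambda>m. real m ^ k) m * r ^ m)"
      by (rule termdiff_converges[where K = 1]) (use Suc in auto)
    then have "summable (\<lambda>m. r * (diffs (\<lambda>m. real m ^ k) m * r ^ m))"
      by (rule summable_mult)
    then have "summable (\<lambda>m. real (Suc m) ^ Suc k * r ^ Suc m)"
      by (simp add: diffs_def mult_ac del: of_nat_Suc)
    then show ?case
      by (subst (asm) summable_Suc_iff)
  qed
  from this[of "norm x"] show ?thesis
    using assms by (simp add: norm_mult norm_power)
qed

lemma power_polylog_sums:
  "norm x < 1 \<Longrightarrow> (\<lambda>m. of_nat m ^ k * x ^ m) sums power_polylog k x"
  unfolding power_polylog_def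
  by (rule summable_sums[OF summable_norm_cancel[OF summable_power_times_powser]])

lemma power_polylog_0: "norm x < 1 \<Longrightarrow> power_polylog 0 x = 1 / (1 - x)"
  by (simp add: power_polylog_def suminf_geometric)

text \<open>The conclusion is about \<open>x * D\<close> because the nome satisfies nome' = 2 pi i
  nome: differentiation in z acts on functions of the nome as 2 pi i times the Euler operator x
  d/dx.\<close>

lemma has_field_derivative_power_polylog:
  assumes "norm x < 1"
  shows "\<exists>D. (power_polylog k has_field_derivative D) (at x) \<and> x * D = power_polylog (Suc k) x"
proof (intro exI conjI)
  let ?c = "\<lambda>m. of_nat m ^ k :: complex"
  show "(power_polylog k has_field_derivative (\<Sum>m. diffs ?c m * x ^ m)) (at x)"
    unfolding power_polylog_def[abs_def]
    by (rule termdiffs_strong'[where K = 1])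
       (use assms in \<open>auto intro: summable_norm_cancel[OF summable_power_times_powser]\<close>)
  have "summable (\<lambda>m. diffs ?c m * x ^ m)"
    by (rule termdiff_converges[where K = 1])
       (use assms in \<open>auto intro: summable_norm_cancel[OF summable_power_times_powser]\<close>)
  then have "(\<lambda>m. x * (diffs ?c m * x ^ m)) sums (x * (\<Sum>m. diffs ?c m * x ^ m))"
    by (intro sums_mult summable_sums)
  then have "(\<lambda>m. of_nat (Suc m) ^ Suc k * x ^ Suc m) sums (x * (\<Sum>m. diffs ?c m * x ^ m))"
    by (simp add: diffs_def mult_ac del: of_nat_Suc)
  moreover have "(\<lambda>m. of_nat (Suc m) ^ Suc k * x ^ Suc m) sums power_polylog (Suc k) x"
    using power_polylog_sums[OF assms, of "Suc k"] by (subst sums_Suc_iff) simp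
  ultimately show "x * (\<Sum>m. diffs ?c m * x ^ m) = power_polylog (Suc k) x"
    by (rule sums_unique2)
qed

text \<open>Euler's formulas in terms of exp(i pi z), a square root of the nome. The fraction
  \<open>1 / (1 - nome z)\<close> is the geometric series \<open>power_polylog 0\<close>, the base
  case for the derivatives below; letting the nome tend to 0 also gives the limit - pi i used for
  the inversion of \<open>E2\<close>.\<close>

lemma pi_cot_nome:
  assumes "Im z > 0"
  shows "of_real pi * cot (of_real pi * z) = of_real pi * \<i> - 2 * of_real pi * \<i> / (1 - nome z)"
proof -
  define e where "e = exp (\<i> * (of_real pi * z))"
  have nome: "nome z = e ^ 2"
    unfolding e_def nome_def power2_eq_square exp_add[symmetric] by (rule arg_cong[where f = exp]) simp
  have e0: "e \<noteq> 0" by (simp add: e_def)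
  have e1: "e ^ 2 \<noteq> 1" using norm_nome_less_1[OF assms] unfolding nome by auto
  have "exp (- (\<i> * (of_real pi * z))) = 1 / e"
    by (simp add: e_def exp_minus divide_inverse)
  then have s: "sin (of_real pi * z) = (e - 1 / e) / (2 * \<i>)"
    and c: "cos (of_real pi * z) = (e + 1 / e) / 2"
    by (simp_all only: sin_exp_eq cos_exp_eq e_def)
  have "sin (of_real pi * z) = (e ^ 2 - 1) / (2 * \<i> * e)" "cos (of_real pi * z) = (e ^ 2 + 1) / (2 * e)"
    unfolding s c using e0 by (simp_all add: field_simps power2_eq_square)
  then have "cot (of_real pi * z) = \<i> * (e ^ 2 + 1) / (e ^ 2 - 1)"
    unfolding cot_def using e0 e1 by simp
  then show ?thesis
    unfolding nome using e1 by (simp add: field_simps)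
qed

text \<open>The Lipschitz formula before the polygamma functions are expanded. Each derivative
  brings a factor 2 pi i and one Euler operator, and the first one removes the constant pi
  i.\<close>

lemma Polygamma_reflection_nome:
  assumes "Im z > 0"
  shows "(-1) ^ k * Polygamma k (1 - z) - Polygamma k z =
    (if k = 0 then of_real pi * \<i> else 0) - (2 * of_real pi * \<i>) ^ Suc k * power_polylog k (nome z)"
  using assms
proof (induction k arbitrary: z)
  case 0
  then have "z \<notin> \<int>" using Ints_complex_Im by force
  then show ?case
    using Digamma_reflection[of z] pi_cot_nome[OF 0] norm_nome_less_1[OF 0] by (simp add: power_polylog_0)
next
  case (Suc k)
  have S: "open {z. Im z > 0}" "{z. Im z > 0} \<inter> \<int> = {}"
    using Ints_complex_Im by (force simp: open_halfspace_Im_gt)+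
  obtain D where D: "(power_polylog k has_field_derivative D) (at (nome z))"
      "nome z * D = power_polylog (Suc k) (nome z)"
    using has_field_derivative_power_polylog[OF norm_nome_less_1[OF Suc.prems]] by blast
  have "(nome has_field_derivative 2 * of_real pi * \<i> * nome z) (at z)"
    unfolding nome_def[abs_def] by (auto intro!: derivative_eq_intros)
  note * = DERIV_chain2[OF D(1) this]
  show ?case
    apply (rule higher_reflection[OF Suc.IH S])
      apply simp
     apply (use Suc.prems in simp)
    apply (rule derivative_eq_intros * refl)+
    apply (simp add: D(2)[symmetric] mult_ac)
    done
qed

section \<open>Lattice sums and Lambert series\<close>

lemma has_sum_int_split:
  fixes f :: "int \<Rightarrow> 'a :: {topological_comm_monoid_add, t3_space}"
  assumes "((\<lambda>n. f (int n)) has_sum a) UNIV" "((\<lambda>n. f (- int (Suc n))) has_sum b) UNIV"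
  shows "(f has_sum (a + b)) UNIV"
proof -
  have "(f has_sum a) (range int)" "(f has_sum b) (range (\<lambda>n. - int (Suc n)))"
    using assms by (auto simp: has_sum_reindex inj_on_def o_def)
  then have "(f has_sum (a + b)) (range int \<union> range (\<lambda>n. - int (Suc n)))"
    by (rule has_sum_Un_disjoint) auto
  also have "range int \<union> range (\<lambda>n. - int (Suc n)) = UNIV"
  proof -
    have "n \<in> range int \<union> range (\<lambda>n. - int (Suc n))" for n
      by (cases n rule: int_cases) auto
    then show ?thesis by blast
  qed
  finally show ?thesis .
qed

lemma summable_on_int_abs:
  fixes f :: "nat \<Rightarrow> real"
  assumes "summable f" "\<And>n. f n \<ge> 0"
  shows "(\<lambda>n. f (nat \<bar>n\<bar>)) summable_on (UNIV :: int set)"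
proof -
  have "f summable_on UNIV" "(\<lambda>n. f (Suc n)) summable_on UNIV"
    using assms by (auto simp: summable_on_UNIV_nonneg_real_iff summable_Suc_iff)
  then obtain a b where "(f has_sum a) UNIV" "((\<lambda>n. f (Suc n)) has_sum b) UNIV"
    by (auto simp: summable_on_def)
  then have "((\<lambda>n. f (nat \<bar>n\<bar>)) has_sum (a + b)) UNIV"
    by (intro has_sum_int_split) (simp_all add: nat_add_distrib del: of_nat_Suc)
  then show ?thesis
    by (auto simp: summable_on_def)
qed

text \<open>The exponent is 3/2. From (1 + |m|)(1 + |n|) <= (1 + |m| + |n|)^2 it follows that, off
  the origin, |mz + n|^(-3) is at most a constant times the product of the weights of m and n. A
  double sum of degree 3 is thus dominated by a product of two convergent single sums.\<close>

definition lattice_weight :: "int \<Rightarrow> real" where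
  "lattice_weight n = 1 / sqrt (1 + \<bar>of_int n\<bar>) ^ 3"

lemma lattice_weight_summable: "lattice_weight summable_on UNIV"
proof -
  have "summable (\<lambda>n. real (Suc n) powr (-3/2))"
    using summable_real_powr_iff[of "-3/2"] by (subst summable_Suc_iff) simp
  moreover have "1 / sqrt (1 + real n) ^ 3 = real (Suc n) powr (-3/2)" for n
  proof -
    have "sqrt (1 + real n) ^ 3 = (1 + real n) powr (3/2)"
      by (simp add: powr_half_sqrt[symmetric] powr_power)
    then show ?thesis by (simp add: powr_minus_divide)
  qed
  ultimately have "summable (\<lambda>n. 1 / sqrt (1 + real n) ^ 3)"
    by simp
  then have "(\<lambda>n. 1 / sqrt (1 + real (nat \<bar>n\<bar>)) ^ 3) summable_on (UNIV :: int set)"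
    by (rule summable_on_int_abs) simp
  then show ?thesis
    by (simp add: lattice_weight_def[abs_def])
qed

lemma lattice_weight_product_summable:
  "(\<lambda>(m, n). lattice_weight m * lattice_weight n) summable_on UNIV"
proof -
  have "(\<lambda>p. norm (case p of (m, n) \<Rightarrow> lattice_weight m * lattice_weight n)) summable_on UNIV \<times> UNIV"
    unfolding Infinite_Sum.abs_summable_on_Sigma_iff
  proof (intro conjI ballI)
    have pos: "lattice_weight n \<ge> 0" for n by (simp add: lattice_weight_def)
    show "(\<lambda>n. norm (case (m, n) of (m, n) \<Rightarrow> lattice_weight m * lattice_weight n)) summable_on UNIV" for m
      using lattice_weight_summable pos by (auto intro: summable_on_cmult_right)
    show "(\<lambda>m. norm (\<Sum>\<^sub>\<infinity>n. norm (case (m, n) of (m, n) \<Rightarrow> lattice_weight m * lattice_weight n))) summable_on UNIV"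
      using lattice_weight_summable pos
      by (auto simp: infsum_cmult_right infsum_nonneg intro: summable_on_cmult_left)
  qed
  then show ?thesis
    by (simp add: Infinite_Sum.abs_summable_summable)
qed

lemma lattice_summable:
  fixes f :: "int \<times> int \<Rightarrow> complex"
  assumes "\<And>m n. norm (f (m, n)) \<le> C * (lattice_weight m * lattice_weight n)"
  shows "f summable_on A"
proof -
  have "(\<lambda>p. C * (case p of (m, n) \<Rightarrow> lattice_weight m * lattice_weight n)) summable_on UNIV"
    by (rule summable_on_cmult_right[OF lattice_weight_product_summable])
  then have "(\<lambda>p. norm (f p)) summable_on UNIV"
    by (rule Infinite_Sum.abs_summable_on_comparison_test') (use assms in auto)
  then show ?thesis
    by (rule summable_on_subset_banach[OF Infinite_Sum.abs_summable_summable]) simp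
qed

lemma lattice_norm_bound:
  assumes "Im z > 0"
  obtains K where "K \<ge> 1" "\<And>m n. \<bar>of_int m\<bar> + \<bar>of_int n\<bar> \<le> K * norm (of_int m * z + of_int n)"
proof
  \<comment> \<open>With X = |mz + n|, the imaginary part gives |m| <= X / Im z, and then the
    triangle inequality gives |n| <= X + |m| |z|. \<open>K\<close> is the sum of the two
    factors.\<close>
  define K where "K = 1 + (1 + norm z) / Im z"
  show "K \<ge> 1" using assms by (simp add: K_def)
  fix m n :: int
  let ?x = "of_int m * z + of_int n"
  have "\<bar>of_int m\<bar> * Im z \<le> norm ?x"
    using abs_Im_le_cmod[of ?x] assms by (simp add: abs_mult)
  then have m: "\<bar>of_int m\<bar> \<le> norm ?x / Im z"
    using assms by (simp add: field_simps)
  have "norm (of_int n :: complex) \<le> norm ?x + norm (of_int m * z)"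
    using norm_triangle_ineq4[of ?x "of_int m * z"] by simp
  then have "\<bar>of_int n\<bar> \<le> norm ?x + \<bar>of_int m\<bar> * norm z"
    by (simp add: norm_mult)
  also have "\<dots> \<le> norm ?x + norm ?x / Im z * norm z"
    using m by (intro add_left_mono mult_right_mono) auto
  finally show "\<bar>of_int m\<bar> + \<bar>of_int n\<bar> \<le> K * norm ?x"
    using m by (simp add: K_def field_simps add_divide_distrib)
qed

lemma lattice_norm_bound_sqrt:
  assumes "Im z > 0"
  obtains K where "K \<ge> 1"
    "\<And>m n. (m, n) \<noteq> (0, 0) \<Longrightarrow>
      sqrt (1 + \<bar>of_int m\<bar>) * sqrt (1 + \<bar>of_int n\<bar>) \<le> K * norm (of_int m * z + of_int n)"
proof -
  obtain K where K: "K \<ge> 1" "\<And>m n. \<bar>of_int m\<bar> + \<bar>of_int n\<bar> \<le> K * norm (of_int m * z + of_int n)"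
    using lattice_norm_bound[OF assms] by blast
  show thesis
  proof
    \<comment> \<open>The factor 2 pays for 1 + |m| + |n| <= 2 (|m| + |n|), which holds because (m,
      n) is not the origin.\<close>
    show "2 * K \<ge> 1" using K by simp
    fix m n :: int
    assume "(m, n) \<noteq> (0, 0)"
    then have "1 \<le> \<bar>m\<bar> + \<bar>n\<bar>" by auto
    then have "of_int 1 \<le> (of_int (\<bar>m\<bar> + \<bar>n\<bar>) :: real)" by (simp only: of_int_le_iff)
    then have 1: "\<bar>of_int m :: real\<bar> + \<bar>of_int n\<bar> \<ge> 1" by simp
    have "sqrt (1 + \<bar>of_int m\<bar>) * sqrt (1 + \<bar>of_int n\<bar>) = sqrt ((1 + \<bar>of_int m\<bar>) * (1 + \<bar>of_int n\<bar>))"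
      by (simp add: real_sqrt_mult)
    also have "\<dots> \<le> sqrt ((1 + (\<bar>of_int m\<bar> + \<bar>of_int n\<bar>)) ^ 2)"
      by (intro real_sqrt_le_mono) (simp add: power2_eq_square algebra_simps)
    also have "\<dots> \<le> 2 * (\<bar>of_int m\<bar> + \<bar>of_int n\<bar>)"
      using 1 by simp
    also have "\<dots> \<le> 2 * K * norm (of_int m * z + of_int n)"
      using K(2)[of m n] by simp
    finally show "sqrt (1 + \<bar>of_int m\<bar>) * sqrt (1 + \<bar>of_int n\<bar>) \<le> 2 * K * norm (of_int m * z + of_int n)" .
  qed
qed

text \<open>Row m of the lattice sum is the value at w = mz. At w = 0 the term n = 0 is 1 / 0 = 0
  for positive s, so row 0 is covered as well.\<close>

definition eisenstein_row :: "nat \<Rightarrow> complex \<Rightarrow> complex" where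
  "eisenstein_row s w = (\<Sum>\<^sub>\<infinity>n\<in>UNIV. 1 / (w + of_int n) ^ s)"

lemma eisenstein_row_summable:
  assumes "Im w > 0" "s \<ge> 2"
  shows "(\<lambda>n. 1 / (w + of_int n) ^ s) summable_on UNIV"
proof -
  obtain K where K: "K \<ge> 1" "\<And>m n. \<bar>of_int m\<bar> + \<bar>of_int n\<bar> \<le> K * norm (of_int m * w + of_int n)"
    using lattice_norm_bound[OF assms(1)] by blast
  have "summable (\<lambda>n. K ^ s / real (Suc n) ^ s)"
    using inverse_power_summable[OF assms(2), where 'a = real]
    by (subst summable_Suc_iff, subst divide_inverse) (intro summable_mult)
  then have "(\<lambda>n. K ^ s / real (Suc (nat \<bar>n\<bar>)) ^ s) summable_on (UNIV :: int set)"
    using K(1) by (intro summable_on_int_abs) auto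
  then have "(\<lambda>n. norm (1 / (w + of_int n) ^ s)) summable_on UNIV"
  proof (rule Infinite_Sum.abs_summable_on_comparison_test')
    fix n :: int
    have "1 + \<bar>of_int n\<bar> \<le> K * norm (w + of_int n)"
      using K(2)[of 1 n] by simp
    then have "(1 + \<bar>of_int n\<bar>) ^ s \<le> (K * norm (w + of_int n)) ^ s"
      by (rule power_mono) simp
    moreover have "w + of_int n \<noteq> 0"
      using assms(1) by (auto simp: complex_eq_iff)
    ultimately show "norm (1 / (w + of_int n) ^ s) \<le> K ^ s / real (Suc (nat \<bar>n\<bar>)) ^ s"
      by (simp add: norm_divide norm_power power_mult_distrib field_simps)
  qed
  then show ?thesis by (rule Infinite_Sum.abs_summable_summable)
qed

lemma eisenstein_row_has_sum:
  assumes "Im w > 0" "s \<ge> 2"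
  shows "((\<lambda>n. 1 / (w + of_int n) ^ s) has_sum eisenstein_row s w) UNIV"
  using eisenstein_row_summable[OF assms] unfolding eisenstein_row_def by simp

lemma eisenstein_row_minus:
  assumes "even s"
  shows "eisenstein_row s (- w) = eisenstein_row s w"
proof -
  have "1 / (- w + of_int n) ^ s = 1 / (w + of_int (- n)) ^ s" for n
    using power_minus_even[OF assms, of "w - of_int n"] by simp
  then show ?thesis
    unfolding eisenstein_row_def
    by (intro infsum_reindex_bij_witness[where i = uminus and j = uminus]) auto
qed

text \<open>The terms with n >= 0 form the series of \<open>Polygamma k w\<close>, those with n < 0
  the series of \<open>Polygamma k (1 - w)\<close>. For odd \<open>k\<close> the power
  \<open>Suc k\<close> is even, so both enter with the same sign and the reflection formula
  evaluates their sum.\<close>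

lemma eisenstein_row_nome:
  assumes "Im w > 0" "odd k"
  shows "eisenstein_row (Suc k) w = (2 * of_real pi * \<i>) ^ Suc k / fact k * power_polylog k (nome w)"
proof -
  have k: "k \<noteq> 0" "Suc k \<ge> 2" using assms(2) by (auto elim: oddE)
  define f where "f n = 1 / (w + of_int n) ^ Suc k" for n
  have "f summable_on UNIV"
    unfolding f_def by (rule eisenstein_row_summable[OF assms(1) k(2)])
  then have "f summable_on range int" "f summable_on range (\<lambda>n. - int (Suc n))"
    by (rule summable_on_subset_banach; simp)+
  then have "(\<lambda>n. f (int n)) summable_on UNIV" "(\<lambda>n. f (- int (Suc n))) summable_on UNIV"
    by (auto simp: summable_on_reindex inj_on_def o_def)
  then have *: "((\<lambda>n. f (int n)) has_sum (\<Sum>n. f (int n))) UNIV"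
      "((\<lambda>n. f (- int (Suc n))) has_sum (\<Sum>n. f (- int (Suc n)))) UNIV"
    by (simp_all only: has_sum_imp_sums[OF has_sum_infsum, THEN sums_unique, symmetric] has_sum_infsum)
  have "Polygamma k w = fact k * (\<Sum>n. f (int n))"
    using k assms(2) by (simp add: Polygamma_def f_def divide_inverse)
  moreover have "f (- int (Suc n)) = inverse ((1 - w + of_nat n) ^ Suc k)" for n
  proof -
    have "w + of_int (- int (Suc n)) = - (1 - w + of_nat n)" by simp
    then have "(w + of_int (- int (Suc n))) ^ Suc k = (1 - w + of_nat n) ^ Suc k"
      using assms(2) by (simp only:) (rule power_minus_even, simp)
    then show ?thesis unfolding f_def by (simp only: divide_inverse mult_1)
  qed
  then have "Polygamma k (1 - w) = fact k * (\<Sum>n. f (- int (Suc n)))"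
    using k assms(2) by (simp add: Polygamma_def)
  moreover have "- Polygamma k (1 - w) - Polygamma k w = - ((2 * of_real pi * \<i>) ^ Suc k * power_polylog k (nome w))"
    using Polygamma_reflection_nome[OF assms(1), of k] k assms(2) by simp
  ultimately have "(\<Sum>n. f (int n)) + (\<Sum>n. f (- int (Suc n)))
      = (2 * of_real pi * \<i>) ^ Suc k / fact k * power_polylog k (nome w)"
    by (simp add: field_simps del: power_Suc of_nat_Suc of_int_minus)
  moreover have "(f has_sum ((\<Sum>n. f (int n)) + (\<Sum>n. f (- int (Suc n))))) UNIV"
    using * by (rule has_sum_int_split)
  ultimately show ?thesis
    using eisenstein_row_has_sum[OF assms(1) k(2)] unfolding f_def by (metis has_sum_unique)
qed

section \<open>Divisor sums and Lambert series\<close>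

definition sigma_series :: "nat \<Rightarrow> complex \<Rightarrow> complex" where
  "sigma_series k x = (\<Sum>n. of_nat (divisor_sigma k (Suc n)) * x ^ Suc n)"

lemma divisor_sigma_le: "n > 0 \<Longrightarrow> divisor_sigma k n \<le> n ^ Suc k"
proof -
  assume n: "n > 0"
  have "divisor_sigma k n \<le> (\<Sum>d | d dvd n. n ^ k)"
    unfolding divisor_sigma_def by (intro sum_mono power_mono) (use n dvd_imp_le in auto)
  also have "\<dots> \<le> n * n ^ k"
  proof -
    have "card {d. d dvd n} \<le> card {1..n}"
      using n by (intro card_mono) (auto simp: Suc_le_eq dest: dvd_imp_le dvd_pos_nat)
    then show ?thesis by simp
  qed
  finally show ?thesis by simp
qed

lemma summable_divisor_sigma:
  assumes "norm (x :: complex) < 1"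
  shows "summable (\<lambda>n. of_nat (divisor_sigma k (Suc n)) * norm x ^ Suc n)"
proof (rule summable_comparison_test')
  have "summable (\<lambda>m. norm (of_nat m ^ Suc k * x ^ m))"
    by (rule summable_power_times_powser[OF assms])
  then show "summable (\<lambda>n. norm (of_nat (Suc n) ^ Suc k * x ^ Suc n))"
    using summable_Suc_iff[of "\<lambda>m. norm (of_nat m ^ Suc k * x ^ m)"] by simp
  fix n :: nat
  have "real (divisor_sigma k (Suc n)) \<le> real (Suc n ^ Suc k)"
    using divisor_sigma_le[of "Suc n" k] by (intro of_nat_mono) simp
  then show "norm (of_nat (divisor_sigma k (Suc n)) * norm x ^ Suc n)
      \<le> norm (of_nat (Suc n) ^ Suc k * x ^ Suc n)"
    unfolding norm_mult norm_power norm_of_nat of_nat_power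
    by (intro mult_mono) (auto simp: norm_power)
qed

lemma sigma_series_has_sum:
  assumes "norm x < 1"
  shows "((\<lambda>n. of_nat (divisor_sigma k (Suc n)) * x ^ Suc n) has_sum sigma_series k x) UNIV"
proof (rule norm_summable_imp_has_sum)
  show *: "summable (\<lambda>n. norm (of_nat (divisor_sigma k (Suc n)) * x ^ Suc n))"
    using summable_divisor_sigma[OF assms, of k] by (simp add: norm_mult norm_power)
  show "(\<lambda>n. of_nat (divisor_sigma k (Suc n)) * x ^ Suc n) sums sigma_series k x"
    unfolding sigma_series_def by (rule summable_sums[OF summable_norm_cancel[OF *]])
qed

lemma power_polylog_has_sum:
  assumes "norm x < 1" "k > 0"
  shows "((\<lambda>m. of_nat m ^ k * x ^ m) has_sum power_polylog k x) {0<..}"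
proof -
  have "((\<lambda>m. of_nat m ^ k * x ^ m) has_sum power_polylog k x) UNIV"
    by (rule norm_summable_imp_has_sum[OF summable_power_times_powser power_polylog_sums]) (rule assms)+
  then show ?thesis
    by (rule has_sum_cong_neutral[THEN iffD1, rotated -1]) (use assms in auto)
qed

text \<open>Both sides sum d^k x^(md) over pairs of positive integers m, d. Grouping by n = md gives
  the divisor sums, and the same grouping for |x| proves absolute convergence, which permits
  regrouping by m.\<close>

lemma lambert_series_has_sum:
  assumes "norm x < 1" "k > 0"
  shows "((\<lambda>m. power_polylog k (x ^ m)) has_sum sigma_series k x) {0<..}"
proof -
  let ?f = "\<lambda>(n, d). of_nat d ^ k * x ^ n"
  let ?A = "Sigma {0<..} (\<lambda>n. {d. d dvd n})"
  have bij: "bij_betw Suc UNIV {0<..}"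
    by (auto simp: bij_betw_def image_iff gr0_conv_Suc)
  have inner: "((\<lambda>d. ?f (n, d)) has_sum (of_nat (divisor_sigma k n) * x ^ n)) {d. d dvd n}"
    if "n \<in> {0<..}" for n
    using that by (intro has_sum_finiteI) (auto simp: divisor_sigma_def sum_distrib_right)
  have outer: "((\<lambda>n. of_nat (divisor_sigma k n) * x ^ n) has_sum sigma_series k x) {0<..}"
    using sigma_series_has_sum[OF assms(1), of k]
      has_sum_reindex_bij_betw[OF bij, of "\<lambda>n. of_nat (divisor_sigma k n) * x ^ n" "sigma_series k x"] by blast
  have "(\<lambda>n. of_nat (divisor_sigma k (Suc n)) * norm x ^ Suc n) summable_on UNIV"
    using summable_divisor_sigma[OF assms(1), of k]
    by (subst summable_on_UNIV_nonneg_real_iff) (auto simp del: power_Suc)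
  then have "(\<lambda>n. of_nat (divisor_sigma k n) * norm x ^ n) summable_on {0<..}"
    using summable_on_reindex_bij_betw[OF bij, of "\<lambda>n. of_nat (divisor_sigma k n) * norm x ^ n"] by blast
  moreover have "(\<Sum>\<^sub>\<infinity>d\<in>{d. d dvd n}. norm (?f (n, d))) = of_nat (divisor_sigma k n) * norm x ^ n"
    if "n \<in> {0<..}" for n
    using that by (auto simp: divisor_sigma_def sum_distrib_right norm_mult norm_power)
  ultimately have "(\<lambda>n. \<Sum>\<^sub>\<infinity>d\<in>{d. d dvd n}. norm (?f (n, d))) summable_on {0<..}"
    by (subst summable_on_cong)
  then have "(\<lambda>p. norm (?f p)) summable_on ?A"
    unfolding Infinite_Sum.abs_summable_on_Sigma_iff by (auto simp: infsum_nonneg)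
  then have "?f summable_on ?A"
    by (rule Infinite_Sum.abs_summable_summable)
  with inner outer have "(?f has_sum sigma_series k x) ?A"
    by (rule has_sum_SigmaI)
  also have "?this \<longleftrightarrow> ((\<lambda>(m, d). of_nat d ^ k * (x ^ m) ^ d) has_sum sigma_series k x) ({0<..} \<times> {0<..})"
    by (rule has_sum_reindex_bij_witness[where i = "\<lambda>(m, d). (m * d, d)" and j = "\<lambda>(n, d). (n div d, d)"])
       (auto simp: power_mult[symmetric] dvd_div_eq_0_iff intro!: Nat.gr0I)
  finally show ?thesis
  proof (rule has_sum_SigmaD)
    fix m :: nat assume "m \<in> {0<..}"
    then have "norm (x ^ m) < 1" using assms by (simp add: norm_power power_less_one_iff)
    then show "((\<lambda>d. case (m, d) of (m, d) \<Rightarrow> of_nat d ^ k * (x ^ m) ^ d) has_sum power_polylog k (x ^ m)) {0<..}"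
      using power_polylog_has_sum[OF _ assms(2)] by simp
  qed
qed

lemma nome_of_nat_mult: "nome (of_nat m * z) = nome z ^ m"
  unfolding nome_def by (simp add: exp_of_nat_mult[symmetric] mult_ac)

text \<open>Rows m and - m agree because the exponent is even, hence the factor 2. Row 0 stays apart
  because the Lipschitz formula needs an argument off the real line.\<close>

lemma eisenstein_row_lattice_has_sum:
  assumes "Im z > 0" "odd k"
  shows "((\<lambda>m. eisenstein_row (Suc k) (of_int m * z)) has_sum
           2 * (2 * of_real pi * \<i>) ^ Suc k / fact k * sigma_series k (nome z)) (- {0})"
proof -
  let ?c = "(2 * of_real pi * \<i>) ^ Suc k / fact k :: complex"
  let ?g = "\<lambda>m. eisenstein_row (Suc k) (of_int m * z)"
  have k: "k > 0" using assms(2) by (auto elim: oddE)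
  have "((\<lambda>m. ?c * power_polylog k (nome z ^ m)) has_sum ?c * sigma_series k (nome z)) {0<..}"
    by (intro has_sum_cmult_right lambert_series_has_sum norm_nome_less_1 assms k)
  also have "?this \<longleftrightarrow> ((\<lambda>m. ?g (int m)) has_sum ?c * sigma_series k (nome z)) {0<..}"
    by (rule has_sum_cong) (use assms in \<open>simp add: eisenstein_row_nome nome_of_nat_mult\<close>)
  finally have *: "((\<lambda>m. ?g (int m)) has_sum ?c * sigma_series k (nome z)) {0<..}" .
  have "(?g has_sum ?c * sigma_series k (nome z)) (int ` {0<..})"
    using * by (subst has_sum_reindex) (auto simp: o_def)
  moreover have "(?g has_sum ?c * sigma_series k (nome z)) ((\<lambda>m. - int m) ` {0<..})"
    using * assms(2) by (subst has_sum_reindex) (auto simp: o_def inj_on_def eisenstein_row_minus)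
  ultimately have "(?g has_sum (?c * sigma_series k (nome z) + ?c * sigma_series k (nome z)))
      (int ` {0<..} \<union> (\<lambda>m. - int m) ` {0<..})"
    by (rule has_sum_Un_disjoint) auto
  moreover have "int ` {0<..} \<union> (\<lambda>m. - int m) ` {0<..} = - {0}"
  proof -
    have "m \<in> int ` {0<..} \<union> (\<lambda>m. - int m) ` {0<..}" if "m \<noteq> 0" for m
      using that by (cases m rule: int_cases4) auto
    then show ?thesis by auto
  qed
  ultimately show ?thesis by (simp add: mult_ac)
qed

text \<open>This is 2 zeta(s), the term n = 0 being 1 / 0 = 0.\<close>

lemma inverse_power_int_has_sum:
  assumes "(\<lambda>n. 1 / real (Suc n) ^ s) sums c" "even s" "s > 0"
  shows "((\<lambda>n. 1 / of_int n ^ s :: complex) has_sum of_real (2 * c)) UNIV"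
proof -
  have "((\<lambda>n. 1 / real (Suc n) ^ s) has_sum c) UNIV"
    using assms(1) by (rule sums_nonneg_imp_has_sum) auto
  then have "((\<lambda>n. of_real (1 / real (Suc n) ^ s) :: complex) has_sum of_real c) UNIV"
    by (rule has_sum_of_real)
  then have *: "((\<lambda>n. 1 / of_nat (Suc n) ^ s :: complex) has_sum of_real c) UNIV"
    by (simp del: of_nat_Suc)
  also have "?this \<longleftrightarrow> ((\<lambda>n. 1 / of_nat n ^ s :: complex) has_sum of_real c) {0<..}"
  proof -
    have bij: "bij_betw Suc UNIV {0<..}"
      by (auto simp: bij_betw_def image_iff gr0_conv_Suc)
    show ?thesis using has_sum_reindex_bij_betw[OF bij, of "\<lambda>n. 1 / of_nat n ^ s :: complex"] by blast
  qed
  also have "\<dots> \<longleftrightarrow> ((\<lambda>n. 1 / of_nat n ^ s :: complex) has_sum of_real c) UNIV"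
    by (rule has_sum_cong_neutral) (use assms(3) in auto)
  finally have 1: "((\<lambda>n. 1 / of_int (int n) ^ s :: complex) has_sum of_real c) UNIV" by simp
  have "((\<lambda>n. 1 / of_int (- int (Suc n)) ^ s :: complex) has_sum of_real c) UNIV"
    using * assms(2) by (simp only: of_int_minus power_minus_even of_int_of_nat_eq)
  from has_sum_int_split[OF 1 this] show ?thesis by simp
qed

section \<open>\<open>E4\<close> as a lattice sum and its inversion\<close>

lemma E4_nome: "E4 z = 1 + 240 * sigma_series 3 (nome z)"
  by (simp add: E4_def sigma_series_def nome_def)

lemma E2_nome: "E2 z = 1 - 24 * sigma_series 1 (nome z)"
  by (simp add: E2_def sigma_series_def nome_def)

lemma inverse_le_if_le_mult:
  fixes a b c :: real
  assumes "a \<le> c * b" "0 < a" "0 < b"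
  shows "1 / b \<le> c * (1 / a)"
  using assms by (simp add: field_simps)

text \<open>The origin contributes nothing to the lattice sum since \<open>1 / 0 = 0\<close>.\<close>

lemma E4_lattice_has_sum:
  assumes "Im z > 0"
  shows "((\<lambda>(m, n). 1 / (of_int m * z + of_int n) ^ 4) has_sum (of_real pi ^ 4 / 45 * E4 z)) UNIV"
proof -
  let ?f = "\<lambda>(m, n). 1 / (of_int m * z + of_int n) ^ 4"
  obtain K where K: "K \<ge> 1"
    "\<And>m n. (m, n) \<noteq> (0, 0) \<Longrightarrow>
      sqrt (1 + \<bar>of_int m\<bar>) * sqrt (1 + \<bar>of_int n\<bar>) \<le> K * norm (of_int m * z + of_int n)"
    using lattice_norm_bound_sqrt[OF assms] by blast
  have "?f summable_on UNIV"
  proof (rule lattice_summable)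
    fix m n :: int
    let ?x = "norm (of_int m * z + of_int n)" and ?s = "sqrt (1 + \<bar>of_int m\<bar>) * sqrt (1 + \<bar>of_int n\<bar>)"
    have s: "?s \<ge> 1" by (intro mult_ge1_I) auto
    show "norm (?f (m, n)) \<le> K ^ 4 * (lattice_weight m * lattice_weight n)"
    proof (cases "(m, n) = (0, 0)")
      case False
      \<comment> \<open>The weights have total degree 3 only, so one factor of the quartic decay is
        given away.\<close>
      have "?s ^ 3 \<le> ?s ^ 4" using s by (rule power_increasing[rotated]) simp
      also have "\<dots> \<le> (K * ?x) ^ 4" using K(2)[OF False] s by (intro power_mono) auto
      finally have *: "?s ^ 3 \<le> K ^ 4 * ?x ^ 4" by (simp only: power_mult_distrib)
      have s0: "?s ^ 3 > 0" by (rule zero_less_power) (use s in linarith)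
      have "?x \<noteq> 0" using K(2)[OF False] s by auto
      then have "?x ^ 4 > 0" by simp
      with * s0 have "1 / ?x ^ 4 \<le> K ^ 4 * (1 / ?s ^ 3)"
        by (rule inverse_le_if_le_mult)
      then show ?thesis
        by (simp add: lattice_weight_def norm_divide norm_power power_mult_distrib)
    qed (use K(1) in \<open>auto simp: lattice_weight_def\<close>)
  qed
  then obtain S where S: "(?f has_sum S) (UNIV \<times> UNIV)"
    by (auto simp: summable_on_def)
  let ?g = "\<lambda>m. eisenstein_row 4 (of_int m * z)"
  have row: "((\<lambda>n. ?f (m, n)) has_sum ?g m) UNIV" for m
  proof -
    have "(\<lambda>n. 1 / (of_int m * z + of_int n) ^ 4) summable_on UNIV"
      by (rule summable_on_SigmaD1[OF has_sum_imp_summable[OF S]]) simp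
    then show ?thesis
      unfolding eisenstein_row_def by simp
  qed
  have "(?g has_sum S) UNIV"
    using S row by (rule has_sum_SigmaD)
  moreover have "(?g has_sum (?g 0 + of_real pi ^ 4 / 45 * (240 * sigma_series 3 (nome z)))) UNIV"
  proof -
    have "(?g has_sum (of_real pi ^ 4 / 45 * (240 * sigma_series 3 (nome z)))) (- {0})"
      \<comment> \<open>2 (2 pi i)^4 / 3! = 240 pi^4 / 45: the coefficient 240 is the ratio to row
        0, which is 2 zeta(4) = pi^4 / 45.\<close>
      using eisenstein_row_lattice_has_sum[OF assms, of 3] by (simp add: fact_numeral power_mult_distrib mult_ac)
    then have "(?g has_sum (?g 0 + of_real pi ^ 4 / 45 * (240 * sigma_series 3 (nome z)))) (insert 0 (- {0}))"
      by (intro has_sum_insert) auto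
    moreover have "insert 0 (- {0}) = (UNIV :: int set)" by auto
    ultimately show ?thesis by simp
  qed
  moreover have "?g 0 = of_real pi ^ 4 / 45"
  proof -
    have "((\<lambda>n. 1 / of_int n ^ 4 :: complex) has_sum of_real (2 * (pi ^ 4 / 90))) UNIV"
      by (rule inverse_power_int_has_sum[OF inverse_fourth_powers_sums]) auto
    moreover have "((\<lambda>n. 1 / of_int n ^ 4 :: complex) has_sum ?g 0) UNIV"
      using row[of 0] by simp
    ultimately have "of_real (2 * (pi ^ 4 / 90)) = ?g 0" by (rule has_sum_unique)
    then show ?thesis by simp
  qed
  ultimately have "S = of_real pi ^ 4 / 45 + of_real pi ^ 4 / 45 * (240 * sigma_series 3 (nome z))"
    using has_sum_unique by metis
  then have "S = of_real pi ^ 4 / 45 * E4 z"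
    by (simp add: E4_nome algebra_simps)
  with S show ?thesis by simp
qed

lemma Im_minus_inverse: "Im z > 0 \<Longrightarrow> Im (- 1 / z) > 0"
  by (auto simp: Im_divide power2_eq_square intro!: divide_pos_pos add_nonneg_pos)

text \<open>The quarter turn (m, n) -> (n, -m) of the index lattice carries the sum at z, multiplied
  by z^4, to the sum at - 1/z. Unordered summation makes this rearrangement legitimate.\<close>

lemma E4_minus_inverse:
  assumes "Im z > 0"
  shows "E4 (- 1 / z) = z ^ 4 * E4 z"
proof -
  let ?f = "\<lambda>z (m, n). 1 / (of_int m * z + of_int n) ^ 4 :: complex"
  have z: "z \<noteq> 0" using assms by auto
  have "?f z (n, - m) * z ^ 4 = ?f (- 1 / z) (m, n)" for m n
  proof -
    have "of_int m * (- 1 / z) + of_int n = (of_int n * z + of_int (- m)) / z"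
      using z by (simp add: field_simps)
    then show ?thesis by (simp add: power_divide)
  qed
  then have iff: "(?f (- 1 / z) has_sum (of_real pi ^ 4 / 45 * E4 (- 1 / z))) UNIV \<longleftrightarrow>
      ((\<lambda>p. ?f z p * z ^ 4) has_sum (of_real pi ^ 4 / 45 * E4 (- 1 / z))) UNIV"
    by (intro has_sum_reindex_bij_witness[where i = "\<lambda>(m, n). (- n, m)" and j = "\<lambda>(m, n). (n, - m)"])
       (auto simp del: of_int_minus)
  have "((\<lambda>p. ?f z p * z ^ 4) has_sum (of_real pi ^ 4 / 45 * E4 z * z ^ 4)) UNIV"
    by (intro has_sum_cmult_left E4_lattice_has_sum assms)
  moreover have "((\<lambda>p. ?f z p * z ^ 4) has_sum (of_real pi ^ 4 / 45 * E4 (- 1 / z))) UNIV"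
    unfolding iff[symmetric] by (rule E4_lattice_has_sum[OF Im_minus_inverse[OF assms]])
  ultimately have "of_real pi ^ 4 / 45 * E4 z * z ^ 4 = of_real pi ^ 4 / 45 * E4 (- 1 / z)"
    by (rule has_sum_unique)
  then have "of_real pi ^ 4 / 45 * E4 (- 1 / z) = of_real pi ^ 4 / 45 * (z ^ 4 * E4 z)"
    by (simp only: mult_ac)
  then show ?thesis
    by (rule mult_left_cancel[THEN iffD1, rotated]) simp
qed

section \<open>Inversion of the weight two Eisenstein series\<close>

text \<open>Half-open intervals are used so that a telescoping sum over them has exactly the
  boundary terms at - N and N.\<close>

lemma has_sum_int_tendsto:
  assumes "(f has_sum S) (UNIV :: int set)"
  shows "(\<lambda>N. \<Sum>n\<in>{- int N..<int N}. f n) \<longlonglongrightarrow> S"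
proof -
  have "filterlim (\<lambda>N. {- int N..<int N}) (finite_subsets_at_top UNIV) sequentially"
    unfolding filterlim_finite_subsets_at_top
  proof (intro allI impI)
    fix X :: "int set" assume "finite X \<and> X \<subseteq> UNIV"
    then obtain b where b: "\<And>x. x \<in> X \<Longrightarrow> \<bar>x\<bar> \<le> b"
      using bdd_above_finite[of "abs ` X"] by (auto simp: bdd_above_def)
    show "\<forall>\<^sub>F N in sequentially. finite {- int N..<int N} \<and> X \<subseteq> {- int N..<int N} \<and> {- int N..<int N} \<subseteq> UNIV"
      using eventually_gt_at_top[of "nat \<bar>b\<bar>"]
    proof eventually_elim
      case (elim N)
      have "x \<in> {- int N..<int N}" if "x \<in> X" for x
        using b[OF that] elim by auto
      then show ?case by auto
    qed
  qed
  from filterlim_compose[OF assms[unfolded has_sum_def] this] show ?thesis .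
qed

lemma sum_int_telescope:
  fixes g :: "int \<Rightarrow> 'a :: ab_group_add"
  shows "(\<Sum>n\<in>{- int N..<int N}. g n - g (n + 1)) = g (- int N) - g (int N)"
proof (induction N)
  case (Suc N)
  have "{- int (Suc N)..<int (Suc N)} = insert (- int (Suc N)) (insert (int N) {- int N..<int N})"
    by auto
  then show ?case
    using Suc by (simp add: add.commute)
qed auto

lemma int_telescope_has_sum_eq:
  fixes g :: "int \<Rightarrow> 'a :: real_normed_vector"
  assumes "((\<lambda>n. g n - g (n + 1)) has_sum S) UNIV"
    and "(\<lambda>N. g (- int N)) \<longlonglongrightarrow> a" "(\<lambda>N. g (int N)) \<longlonglongrightarrow> b"
  shows "S = a - b"
proof -
  have "(\<lambda>N. g (- int N) - g (int N)) \<longlonglongrightarrow> S"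
    using has_sum_int_tendsto[OF assms(1)] by (simp only: sum_int_telescope)
  moreover have "(\<lambda>N. g (- int N) - g (int N)) \<longlonglongrightarrow> a - b"
    by (rule tendsto_diff[OF assms(2,3)])
  ultimately show ?thesis by (rule LIMSEQ_unique)
qed

text \<open>Pairing k with - k can create convergence that the unordered sum does not have, as for
  1/n. Once summability is known by other means, the paired value is the sum.\<close>

lemma has_sum_nonzero_int:
  fixes f :: "int \<Rightarrow> complex"
  assumes "f summable_on (- {0})" "(\<lambda>k. f (int (Suc k)) + f (- int (Suc k))) sums S"
  shows "(f has_sum S) (- {0})"
proof -
  let ?P = "range (\<lambda>k. int (Suc k))" and ?M = "range (\<lambda>k. - int (Suc k))"
  have "n \<in> ?P \<union> ?M" if "n \<noteq> 0" for n
    using that by (cases n rule: int_cases3) (auto simp: image_iff gr0_conv_Suc)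
  then have split: "- {0} = ?P \<union> ?M" by auto
  have "f summable_on ?P" "f summable_on ?M"
    by (rule summable_on_subset_banach[OF assms(1)]; auto)+
  then obtain a b where ab: "(f has_sum a) ?P" "(f has_sum b) ?M"
    by (auto simp: summable_on_def)
  then have "(\<lambda>k. f (int (Suc k))) sums a" "(\<lambda>k. f (- int (Suc k))) sums b"
    by (auto simp: has_sum_reindex inj_on_def o_def intro!: has_sum_imp_sums)
  then have "(\<lambda>k. f (int (Suc k)) + f (- int (Suc k))) sums (a + b)"
    by (rule sums_add)
  then have "S = a + b"
    using assms(2) by (rule sums_unique2[symmetric])
  moreover have "(f has_sum (a + b)) (?P \<union> ?M)"
    using ab by (rule has_sum_Un_disjoint) auto
  ultimately show ?thesis by (simp add: split)
qed

text \<open>Subtract the Digamma series at w + 1 from the one at 1 - w: Euler's constant and the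
  terms 1/(k+1) cancel. The shift from w to w + 1 accounts for - 1/w.\<close>

lemma cot_partial_fractions:
  fixes w :: complex
  assumes "w \<notin> \<int>"
  shows "(\<lambda>m. 1 / (w + of_nat (Suc m)) + 1 / (w - of_nat (Suc m))) sums
           (of_real pi * cot (of_real pi * w) - 1 / w)"
proof -
  have w: "w \<noteq> 0" using assms by auto
  have w1: "w + 1 \<noteq> 0" "1 - w \<noteq> 0"
    using assms by (auto simp: add_eq_0_iff2)
  have D: "(\<lambda>k. inverse (of_nat (Suc k)) - inverse (x + of_nat k)) sums (Digamma x + euler_mascheroni)"
    if "x \<noteq> 0" for x :: complex
    using summable_sums[OF summable_Digamma[OF that]] by (simp add: Digamma_def)
  have "(\<lambda>k. (inverse (of_nat (Suc k)) - inverse (1 - w + of_nat k)) -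
           (inverse (of_nat (Suc k)) - inverse (w + 1 + of_nat k))) sums
           ((Digamma (1 - w) + euler_mascheroni) - (Digamma (w + 1) + euler_mascheroni))"
    by (intro sums_diff D w1)
  also have "(Digamma (1 - w) + euler_mascheroni) - (Digamma (w + 1) + euler_mascheroni)
      = of_real pi * cot (of_real pi * w) - 1 / w"
    using Digamma_reflection[OF assms] Polygamma_plus1[OF w, of 0] by (simp add: algebra_simps)
  also have "(\<lambda>k. (inverse (of_nat (Suc k)) - inverse (1 - w + of_nat k)) -
           (inverse (of_nat (Suc k)) - inverse (w + 1 + of_nat k)))
      = (\<lambda>m. 1 / (w + of_nat (Suc m)) + 1 / (w - of_nat (Suc m)))"
  proof
    fix k
    have "1 - w + of_nat k = - (w - of_nat (Suc k))" "w + 1 + of_nat k = w + of_nat (Suc k)"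
      by simp_all
    then show "(inverse (of_nat (Suc k)) - inverse (1 - w + of_nat k)) -
           (inverse (of_nat (Suc k)) - inverse (w + 1 + of_nat k))
      = 1 / (w + of_nat (Suc k)) + 1 / (w - of_nat (Suc k))"
      by (simp only: inverse_minus_eq) (simp add: divide_inverse)
  qed
  finally show ?thesis .
qed

lemma eisenstein_row_has_sum':
  assumes "Im w \<noteq> 0" "s \<ge> 2" "even s"
  shows "((\<lambda>n. 1 / (w + of_int n) ^ s) has_sum eisenstein_row s w) UNIV"
proof (cases "Im w > 0")
  case False
  then have "((\<lambda>n. 1 / (- w + of_int n) ^ s) has_sum eisenstein_row s (- w)) UNIV"
    using assms by (intro eisenstein_row_has_sum) auto
  moreover have "1 / (- w + of_int n) ^ s = 1 / (w + of_int (- n)) ^ s" for n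
    using power_minus_even[OF assms(3), of "w - of_int n"] by simp
  then have "((\<lambda>n. 1 / (- w + of_int n) ^ s) has_sum eisenstein_row s (- w)) UNIV \<longleftrightarrow>
      ((\<lambda>n. 1 / (w + of_int n) ^ s) has_sum eisenstein_row s (- w)) UNIV"
    by (intro has_sum_reindex_bij_witness[where i = uminus and j = uminus]) auto
  ultimately show ?thesis
    using eisenstein_row_minus[OF assms(3), of w] by simp
qed (use assms eisenstein_row_has_sum in auto)

text \<open>The value of the symmetric sum of \<open>1 / (m z + n)\<close> over all \<open>m \<noteq> 0\<close>.\<close>

definition column_cot :: "complex \<Rightarrow> int \<Rightarrow> complex" where
  "column_cot z n = (if n = 0 then 0 else
     (of_real pi * cot (of_real pi * (of_int n / z)) - z / of_int n) / z)"

lemma column_cot_minus: "column_cot z (- n) = - column_cot z n"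
  by (simp add: column_cot_def diff_divide_distrib)

lemma Im_of_int_divide_nonzero: "Im z > 0 \<Longrightarrow> n \<noteq> 0 \<Longrightarrow> Im (of_int n / z) \<noteq> 0"
  by (auto simp: Im_divide)

lemma column_cot_sums:
  assumes "Im z > 0"
  shows "(\<lambda>k. 1 / (of_int (int (Suc k)) * z + of_int n) + 1 / (of_int (- int (Suc k)) * z + of_int n))
           sums column_cot z n"
proof (cases "n = 0")
  case False
  let ?w = "of_int n / z"
  have z: "z \<noteq> 0" using assms by auto
  have "?w \<notin> \<int>"
    using Im_of_int_divide_nonzero[OF assms False] Ints_complex_Im by metis
  then have "(\<lambda>m. (1 / (?w + of_nat (Suc m)) + 1 / (?w - of_nat (Suc m))) / z) sums
           ((of_real pi * cot (of_real pi * ?w) - 1 / ?w) / z)"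
    by (intro sums_divide cot_partial_fractions)
  moreover have "(1 / (?w + of_nat (Suc m)) + 1 / (?w - of_nat (Suc m))) / z
      = 1 / (of_int (int (Suc m)) * z + of_int n) + 1 / (of_int (- int (Suc m)) * z + of_int n)" for m
  proof -
    have "(?w + of_nat (Suc m)) * z = of_int (int (Suc m)) * z + of_int n"
         "(?w - of_nat (Suc m)) * z = of_int (- int (Suc m)) * z + of_int n"
      using z by (simp_all add: field_simps)
    then show ?thesis
      by (simp only: add_divide_distrib divide_divide_eq_left)
  qed
  ultimately have "(\<lambda>k. 1 / (of_int (int (Suc k)) * z + of_int n) + 1 / (of_int (- int (Suc k)) * z + of_int n))
           sums ((of_real pi * cot (of_real pi * ?w) - 1 / ?w) / z)"
    by (simp only:)
  then show ?thesis
    using False by (simp add: column_cot_def)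
next
  case True
  have "of_int (- int (Suc k)) * z = - (of_int (int (Suc k)) * z)" for k
    by (simp add: algebra_simps)
  then show ?thesis
    using True by (simp only: column_cot_def of_int_0 add_0_right divide_minus_right) simp
qed

text \<open>The point - N/z = N (- 1/z) lies in the upper half plane and has nome q^N, which tends
  to 0. So pi cot tends to pi i - 2 pi i, while the correction z/N vanishes.\<close>

lemma column_cot_tendsto:
  assumes "Im z > 0"
  shows "(\<lambda>N. column_cot z (- int N)) \<longlonglongrightarrow> - (of_real pi * \<i>) / z"
proof -
  define q where "q = nome (- 1 / z)"
  have q: "norm q < 1"
    unfolding q_def by (rule norm_nome_less_1[OF Im_minus_inverse[OF assms]])
  have "(\<lambda>N. (of_real pi * \<i> - 2 * of_real pi * \<i> / (1 - q ^ N) + z * inverse (of_nat N)) / z)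
      \<longlonglongrightarrow> (of_real pi * \<i> - 2 * of_real pi * \<i> / (1 - 0) + z * 0) / z"
    using assms by (intro tendsto_intros LIMSEQ_power_zero q lim_inverse_n) auto
  moreover have "\<forall>\<^sub>F N in sequentially. (of_real pi * \<i> - 2 * of_real pi * \<i> / (1 - q ^ N) + z * inverse (of_nat N)) / z
      = column_cot z (- int N)"
    using eventually_gt_at_top[of 0]
  proof eventually_elim
    case (elim N)
    have "of_int (- int N) / z = of_nat N * (- 1 / z)" by simp
    moreover have "Im (of_nat N * (- 1 / z)) > 0"
    proof -
      have *: "Im (of_nat N * w) > 0" if "Im w > 0" for w
        using elim that by simp
      show ?thesis
        by (rule *[OF Im_minus_inverse[OF assms]])
    qed
    ultimately have "of_real pi * cot (of_real pi * (of_int (- int N) / z))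
        = of_real pi * \<i> - 2 * of_real pi * \<i> / (1 - q ^ N)"
      using pi_cot_nome by (simp only: nome_of_nat_mult q_def)
    then show ?case
      using elim by (simp add: column_cot_def divide_inverse)
  qed
  ultimately have "(\<lambda>N. column_cot z (- int N)) \<longlonglongrightarrow>
      (of_real pi * \<i> - 2 * of_real pi * \<i> / (1 - 0) + z * 0) / z"
    by (rule Lim_transform_eventually)
  then show ?thesis by (simp add: mult.commute)
qed

lemma inverse_of_int_mult_add_tendsto_0:
  "(\<lambda>N. 1 / (w + of_int (int N)) :: complex) \<longlonglongrightarrow> 0" "(\<lambda>N. 1 / (w + of_int (- int N)) :: complex) \<longlonglongrightarrow> 0"
proof -
  have *: "(\<lambda>N. inverse (w + of_nat N :: complex)) \<longlonglongrightarrow> 0" for w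
    by (intro filterlim_compose[OF tendsto_inverse_0] tendsto_add_filterlim_at_infinity[OF tendsto_const] tendsto_of_nat)
  show "(\<lambda>N. 1 / (w + of_int (int N)) :: complex) \<longlonglongrightarrow> 0"
    using *[of w] by (simp add: divide_inverse)
  have "1 / (w + of_int (- int N)) = - inverse (- w + of_nat N)" for N
  proof -
    have "w + of_int (- int N) = - (- w + of_nat N)" by simp
    then show ?thesis by (simp only: inverse_minus_eq divide_inverse mult_1)
  qed
  then show "(\<lambda>N. 1 / (w + of_int (- int N)) :: complex) \<longlonglongrightarrow> 0"
    using tendsto_minus[OF *[of "- w"]] by simp
qed

text \<open>Needed because the cubic term below involves the neighbouring points n and n +
  1.\<close>

lemma lattice_weight_shift: "lattice_weight (n + 1) \<le> 8 * lattice_weight n"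
proof -
  have "sqrt (1 + \<bar>of_int n\<bar>) \<le> sqrt (2 ^ 2 * (1 + \<bar>of_int (n + 1)\<bar>))"
    by (intro real_sqrt_le_mono) (simp add: abs_if)
  also have "\<dots> = 2 * sqrt (1 + \<bar>of_int (n + 1)\<bar>)"
    by (simp only: real_sqrt_mult real_sqrt_abs)
  finally have "sqrt (1 + \<bar>of_int n\<bar>) ^ 3 \<le> (2 * sqrt (1 + \<bar>of_int (n + 1)\<bar>)) ^ 3"
    by (rule power_mono) simp
  then have "sqrt (1 + \<bar>of_int n\<bar>) ^ 3 \<le> 8 * sqrt (1 + \<bar>of_int (n + 1)\<bar>) ^ 3"
    by (simp only: power_mult_distrib) simp
  moreover have "sqrt (1 + \<bar>of_int k\<bar>) ^ 3 > 0" for k :: int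
    by (intro zero_less_power real_sqrt_gt_zero) auto
  ultimately show ?thesis
    unfolding lattice_weight_def by (intro inverse_le_if_le_mult)
qed

lemma one_le_mult_sqrt: "1 \<le> sqrt (1 + \<bar>x\<bar>) * sqrt (1 + \<bar>y\<bar>)"
  by (intro mult_ge1_I) auto

text \<open>By \<open>cubic_partial_fractions\<close> the summand is 1/x^2 minus the telescoping
  term. Over a plane lattice |x|^(-s) is summable for s > 2, so degree 3 suffices where degree 2
  just fails.\<close>

lemma lattice_cubic_summable:
  assumes "Im z > 0"
  shows "(\<lambda>(m, n). 1 / ((of_int m * z + of_int n) ^ 2 * (of_int m * z + of_int n + 1)))
           summable_on ((- {0}) \<times> UNIV)"
proof -
  let ?x = "\<lambda>m n. of_int m * z + of_int n"
  obtain K where K: "K \<ge> 1"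
    "\<And>m n. (m, n) \<noteq> (0, 0) \<Longrightarrow>
      sqrt (1 + \<bar>of_int m\<bar>) * sqrt (1 + \<bar>of_int n\<bar>) \<le> K * norm (?x m n)"
    using lattice_norm_bound_sqrt[OF assms] by blast
  have bound: "1 / norm (?x m n) ^ 3 \<le> K ^ 3 * (lattice_weight m * lattice_weight n)" if "m \<noteq> 0" for m n
  proof -
    let ?s = "sqrt (1 + \<bar>of_int m\<bar>) * sqrt (1 + \<bar>of_int n\<bar>)"
    have s: "?s \<ge> 1" by (rule one_le_mult_sqrt)
    have *: "?s \<le> K * norm (?x m n)" using K(2)[of m n] that by simp
    then have "?s ^ 3 \<le> (K * norm (?x m n)) ^ 3" using s by (intro power_mono) auto
    then have "?s ^ 3 \<le> K ^ 3 * norm (?x m n) ^ 3" by (simp only: power_mult_distrib)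
    moreover have "?s ^ 3 > 0" by (rule zero_less_power) (use s in linarith)
    moreover have "?x m n \<noteq> 0" using * s by auto
    then have "norm (?x m n) ^ 3 > 0" by simp
    ultimately have "1 / norm (?x m n) ^ 3 \<le> K ^ 3 * (1 / ?s ^ 3)"
      by (rule inverse_le_if_le_mult)
    then show ?thesis
      by (simp add: lattice_weight_def power_mult_distrib)
  qed
  \<comment> \<open>Splits the mixed product at two neighbouring points into pure cubes, to which
    \<open>bound\<close> applies one at a time.\<close>
  have amgm: "a ^ 2 * b \<le> a ^ 3 + b ^ 3" if "a \<ge> 0" "b \<ge> 0" for a b :: real
  proof (cases "a \<le> b")
    case True
    then have "a ^ 2 * b \<le> b ^ 2 * b" using that by (intro mult_right_mono power_mono) auto
    then show ?thesis using that by (simp add: power2_eq_square power3_eq_cube add_increasing)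
  next
    case False
    then have "a ^ 2 * b \<le> a ^ 2 * a" using that by (intro mult_left_mono) auto
    then show ?thesis using that by (simp add: power2_eq_square power3_eq_cube add_increasing2)
  qed
  \<comment> \<open>Row 0 is set to 0 because \<open>lattice_summable\<close> asks for a bound at
    all pairs.\<close>
  let ?b = "\<lambda>(m, n). if m = 0 then 0 else 1 / (?x m n ^ 2 * (?x m n + 1))"
  have "?b summable_on ((- {0}) \<times> UNIV)"
  proof (rule lattice_summable)
    fix m n :: int
    show "norm (?b (m, n)) \<le> 9 * K ^ 3 * (lattice_weight m * lattice_weight n)"
    proof (cases "m = 0")
      case False
      have "norm (?b (m, n)) = (1 / norm (?x m n)) ^ 2 * (1 / norm (?x m (n + 1)))"
        using False by (simp add: norm_divide norm_mult norm_power power_divide add.assoc)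
      also have "\<dots> \<le> (1 / norm (?x m n)) ^ 3 + (1 / norm (?x m (n + 1))) ^ 3"
        by (rule amgm) auto
      also have "\<dots> \<le> K ^ 3 * (lattice_weight m * lattice_weight n) + K ^ 3 * (lattice_weight m * lattice_weight (n + 1))"
        using bound[OF False, of n] bound[OF False, of "n + 1"] by (simp add: power_divide)
      also have "\<dots> \<le> K ^ 3 * (lattice_weight m * lattice_weight n) + K ^ 3 * (lattice_weight m * (8 * lattice_weight n))"
        using K(1) lattice_weight_shift[of n]
        by (intro add_left_mono mult_left_mono) (auto simp: lattice_weight_def)
      also have "\<dots> = 9 * K ^ 3 * (lattice_weight m * lattice_weight n)"
        by (simp add: algebra_simps)
      finally show ?thesis .
    qed (use K(1) in \<open>simp add: lattice_weight_def\<close>)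
  qed
  then show ?thesis
    by (rule summable_on_cong[THEN iffD1, rotated]) (auto split: if_splits)
qed

lemma cubic_partial_fractions:
  fixes x :: complex
  assumes "x \<noteq> 0" "x + 1 \<noteq> 0"
  shows "1 / (x ^ 2 * (x + 1)) = 1 / x ^ 2 - (1 / x - 1 / (x + 1))"
proof -
  have "1 / x ^ 2 - (1 / x - 1 / (x + 1)) = ((x + 1) - x * (x + 1) + x ^ 2) / (x ^ 2 * (x + 1))"
    using assms by (simp add: divide_simps power2_eq_square) (simp add: algebra_simps)
  also have "(x + 1) - x * (x + 1) + x ^ 2 = 1"
    by (simp add: algebra_simps power2_eq_square)
  finally show ?thesis by simp
qed

text \<open>The absolutely convergent sum \<open>B\<close> is evaluated twice. Rows give
  \<open>P * (E2 z - 1)\<close>. Columns give the series for \<open>E2 (- 1 / z)\<close> minus the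
  sum of the column sums of \<open>c\<close>, which telescopes in n to - 2 pi i / z; this nonzero
  value produces the term 6z / (pi i).\<close>

lemma E2_minus_inverse:
  assumes "Im z > 0"
  shows "E2 (- 1 / z) = z ^ 2 * E2 z + 6 * z / (of_real pi * \<i>)"
proof -
  let ?x = "\<lambda>m n. of_int m * z + of_int n"
  define r where "r m n = 1 / ?x m n ^ 2" for m n
  define c where "c m n = 1 / ?x m n - 1 / ?x m (n + 1)" for m n
  define b where "b m n = 1 / (?x m n ^ 2 * (?x m n + 1))" for m n
  define u where "u = column_cot z"
  \<comment> \<open>2 zeta(2), the row m = 0; the coefficient of \<open>E2\<close> arises from 2 (2
    pi i)^2 = - 24 \<open>P\<close>.\<close>
  define P where "P = of_real pi ^ 2 / (3 :: complex)"
  let ?A = "- {0 :: int}" and ?U = "UNIV :: int set"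
  have z: "z \<noteq> 0" using assms by auto
  have nz: "?x m n \<noteq> 0" if "m \<noteq> 0" for m n
    using that assms by (auto simp: complex_eq_iff)
  have b_eq: "b m n = r m n - c m n" if "m \<noteq> 0" for m n
  proof -
    have "?x m n + 1 = ?x m (n + 1)" by simp
    then show ?thesis
      using cubic_partial_fractions[of "?x m n"] nz[OF that, of n] nz[OF that, of "n + 1"]
      unfolding b_def r_def c_def by (simp only:) simp
  qed
  obtain B where B: "((\<lambda>(m, n). b m n) has_sum B) (?A \<times> ?U)"
    using lattice_cubic_summable[OF assms] unfolding b_def summable_on_def by auto
  have bm: "(\<lambda>n. b m n) summable_on ?U" if "m \<in> ?A" for m
    by (rule summable_on_SigmaD1[OF has_sum_imp_summable[OF B] that])
  have B': "((\<lambda>(n, m). b m n) has_sum B) (?U \<times> ?A)"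
    using B has_sum_swap[where f = "\<lambda>(m, n). b m n" and S = B and A = ?A and B = ?U] by simp
  have bn: "(\<lambda>m. b m n) summable_on ?A" for n
    by (rule summable_on_SigmaD1[OF has_sum_imp_summable[OF B']]) simp
  have inverse_squares: "((\<lambda>n. 1 / of_int n ^ 2 :: complex) has_sum P) UNIV"
  proof -
    have "(\<lambda>n. 1 / real (Suc n) ^ 2) sums (pi ^ 2 / 6)"
      using inverse_squares_sums by (simp add: add.commute)
    from inverse_power_int_has_sum[OF this] show ?thesis by (simp add: P_def)
  qed

  \<comment> \<open>Along a row the telescoping terms add up to 0, so \<open>b\<close> and
    \<open>r\<close> have the same row sums.\<close>
  have row: "((\<lambda>n. b m n) has_sum eisenstein_row 2 (of_int m * z)) ?U" if "m \<in> ?A" for m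
  proof -
    have m: "m \<noteq> 0" using that by simp
    then have R: "((\<lambda>n. r m n) has_sum eisenstein_row 2 (of_int m * z)) ?U"
      unfolding r_def using assms by (intro eisenstein_row_has_sum') auto
    obtain \<beta> where \<beta>: "((\<lambda>n. b m n) has_sum \<beta>) ?U"
      using bm[of m] m by (auto simp: summable_on_def)
    have "((\<lambda>n. r m n - b m n) has_sum (eisenstein_row 2 (of_int m * z) - \<beta>)) ?U"
      using has_sum_add[OF R has_sum_uminusI[OF \<beta>]] by simp
    then have "((\<lambda>n. 1 / ?x m n - 1 / ?x m (n + 1)) has_sum (eisenstein_row 2 (of_int m * z) - \<beta>)) ?U"
      using m by (simp add: b_eq c_def)
    then have "eisenstein_row 2 (of_int m * z) - \<beta> = 0 - 0"
      by (rule int_telescope_has_sum_eq) (rule inverse_of_int_mult_add_tendsto_0)+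
    with \<beta> show ?thesis by simp
  qed
  have "((\<lambda>m. eisenstein_row 2 (of_int m * z)) has_sum B) ?A"
    by (rule has_sum_SigmaD[OF B]) (use row in simp)
  moreover have lattice: "((\<lambda>m. eisenstein_row 2 (of_int m * w)) has_sum P * (E2 w - 1)) ?A" if "Im w > 0" for w
    using eisenstein_row_lattice_has_sum[OF that, of 1]
    by (simp add: P_def E2_nome power_mult_distrib numeral_2_eq_2[symmetric] mult_ac)
  ultimately have B_eq: "B = P * (E2 z - 1)"
    using has_sum_unique[OF _ lattice[OF assms]] by blast

  \<comment> \<open>The column sums of \<open>r\<close> without m = 0. Dividing mz + n by z turns
    column n into a row of the lattice sum for - 1/z; for n other than 0 the term 1/n^2 at m = 0 is
    taken off again.\<close>
  define Y where "Y n = (if n = 0 then P / z ^ 2 else eisenstein_row 2 (of_int n * (- 1 / z)) / z ^ 2 - 1 / of_int n ^ 2)" for n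
  have col_r: "((\<lambda>m. r m n) has_sum Y n) ?A" for n
  proof (cases "n = 0")
    case True
    have "((\<lambda>m. 1 / of_int m ^ 2 / z ^ 2) has_sum P / z ^ 2) UNIV"
      by (rule has_sum_divide_const[OF inverse_squares])
    then have "((\<lambda>m. 1 / of_int m ^ 2 / z ^ 2) has_sum P / z ^ 2) ?A"
      by (rule has_sum_cong_neutral[THEN iffD1, rotated -1]) auto
    then show ?thesis
      using True by (simp add: Y_def r_def power_mult_distrib)
  next
    case False
    have "eisenstein_row 2 (of_int n / z) = eisenstein_row 2 (of_int n * (- 1 / z))"
      using eisenstein_row_minus[of 2 "of_int n / z"] by simp
    then have "((\<lambda>m. 1 / (of_int n / z + of_int m) ^ 2 / z ^ 2) has_sum
        eisenstein_row 2 (of_int n * (- 1 / z)) / z ^ 2) UNIV"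
      using eisenstein_row_has_sum'[OF Im_of_int_divide_nonzero[OF assms False], of 2]
      by (intro has_sum_divide_const) simp
    moreover have "1 / (of_int n / z + of_int m) ^ 2 / z ^ 2 = r m n" for m
    proof -
      have "(of_int n / z + of_int m) * z = ?x m n" using z by (simp add: field_simps)
      then show ?thesis
        unfolding r_def by (simp only: divide_divide_eq_left power_mult_distrib[symmetric])
    qed
    ultimately have "((\<lambda>m. r m n) has_sum eisenstein_row 2 (of_int n * (- 1 / z)) / z ^ 2) (insert 0 ?A)"
      by (simp add: insert_absorb Compl_eq_Diff_UNIV)
    moreover have "((\<lambda>m. r m n) has_sum r 0 n) {0}"
      by (rule has_sum_finiteI) auto
    ultimately have "((\<lambda>m. r m n) has_sum (eisenstein_row 2 (of_int n * (- 1 / z)) / z ^ 2 - r 0 n)) (insert 0 ?A - {0})"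
      by (rule has_sum_Diff) auto
    then show ?thesis
      using False by (simp add: Y_def r_def)
  qed
  \<comment> \<open>Unordered summability comes from \<open>c = r - b\<close>; the value then comes
    from the symmetric cotangent sums.\<close>
  have col_c: "((\<lambda>m. c m n) has_sum (u n - u (n + 1))) ?A" for n
  proof (rule has_sum_nonzero_int)
    have "(\<lambda>m. r m n - b m n) summable_on ?A"
      using summable_on_add[OF has_sum_imp_summable[OF col_r] summable_on_uminus[THEN iffD2, OF bn]] by simp
    then show "(\<lambda>m. c m n) summable_on ?A"
      by (rule summable_on_cong[THEN iffD1, rotated]) (simp add: b_eq)
    show "(\<lambda>k. c (int (Suc k)) n + c (- int (Suc k)) n) sums (u n - u (n + 1))"
      using sums_diff[OF column_cot_sums[OF assms, of n] column_cot_sums[OF assms, of "n + 1"]]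
      unfolding c_def u_def by (simp only: add_diff_add)
  qed
  have "((\<lambda>m. b m n) has_sum (Y n - (u n - u (n + 1)))) ?A" for n
  proof -
    have "((\<lambda>m. r m n - c m n) has_sum (Y n - (u n - u (n + 1)))) ?A"
      using has_sum_add[OF col_r[of n] has_sum_uminusI[OF col_c[of n]]]
      by (simp only: diff_conv_add_uminus)
    then show ?thesis
      by (rule has_sum_cong[THEN iffD1, rotated]) (simp add: b_eq)
  qed
  then have X: "((\<lambda>n. Y n - (u n - u (n + 1))) has_sum B) ?U"
    by (intro has_sum_SigmaD[OF B']) simp
  have Y: "(Y has_sum (P * E2 (- 1 / z) / z ^ 2 - P)) ?U"
  proof -
    have "((\<lambda>n. 1 / of_int n ^ 2) has_sum P) ?A"
      using inverse_squares by (rule has_sum_cong_neutral[THEN iffD1, rotated -1]) auto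
    moreover have "((\<lambda>n. eisenstein_row 2 (of_int n * (- 1 / z)) / z ^ 2) has_sum P * (E2 (- 1 / z) - 1) / z ^ 2) ?A"
      by (rule has_sum_divide_const[OF lattice[OF Im_minus_inverse[OF assms]]])
    ultimately have "((\<lambda>n. eisenstein_row 2 (of_int n * (- 1 / z)) / z ^ 2 - 1 / of_int n ^ 2) has_sum
        (P * (E2 (- 1 / z) - 1) / z ^ 2 - P)) ?A"
      using has_sum_add[OF _ has_sum_uminusI] by (simp only: diff_conv_add_uminus)
    then have "(Y has_sum (P * (E2 (- 1 / z) - 1) / z ^ 2 - P)) ?A"
      by (rule has_sum_cong[THEN iffD1, rotated]) (simp add: Y_def)
    then have "(Y has_sum (Y 0 + (P * (E2 (- 1 / z) - 1) / z ^ 2 - P))) (insert 0 ?A)"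
      by (intro has_sum_insert) auto
    moreover have "insert 0 ?A = ?U" by auto
    moreover have "Y 0 + (P * (E2 (- 1 / z) - 1) / z ^ 2 - P) = P * E2 (- 1 / z) / z ^ 2 - P"
      by (simp add: Y_def diff_divide_distrib right_diff_distrib)
    ultimately show ?thesis by (simp only:)
  qed
  \<comment> \<open>The difference of two unordered sums is again one, so the telescoping series is
    determined by the limits of \<open>u\<close> at both ends.\<close>
  have "((\<lambda>n. u n - u (n + 1)) has_sum (P * E2 (- 1 / z) / z ^ 2 - P - B)) ?U"
    using has_sum_add[OF Y has_sum_uminusI[OF X]] by simp
  then have "P * E2 (- 1 / z) / z ^ 2 - P - B = - (of_real pi * \<i>) / z - - (- (of_real pi * \<i>) / z)"
  proof (rule int_telescope_has_sum_eq)
    show *: "(\<lambda>N. u (- int N)) \<longlonglongrightarrow> - (of_real pi * \<i>) / z"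
      unfolding u_def by (rule column_cot_tendsto[OF assms])
    show "(\<lambda>N. u (int N)) \<longlonglongrightarrow> - (- (of_real pi * \<i>) / z)"
      using tendsto_minus[OF *] by (simp add: u_def column_cot_minus)
  qed
  then have "P * E2 (- 1 / z) / z ^ 2 = P * E2 z - 2 * (of_real pi * \<i>) / z"
    by (simp add: B_eq algebra_simps)
  then have "P * E2 (- 1 / z) = P * (z ^ 2 * E2 z) - 2 * (of_real pi * \<i>) * z"
    using z by (simp add: field_simps power2_eq_square)
  also have "2 * (of_real pi * \<i>) * z = - (P * (6 * z / (of_real pi * \<i>)))"
    by (simp add: P_def field_simps power2_eq_square)
  finally have "P * E2 (- 1 / z) = P * (z ^ 2 * E2 z + 6 * z / (of_real pi * \<i>))"
    by (simp only: diff_minus_eq_add distrib_left)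
  moreover have "P \<noteq> 0" by (simp add: P_def)
  ultimately show ?thesis by (simp only: mult_cancel_left) simp
qed

section \<open>Transformation under the modular group\<close>

lemma nome_add_of_int: "nome (z + of_int k) = nome z"
proof -
  have "nome (z + of_int k) = nome z * exp (2 * of_int k * of_real pi * \<i>)"
    unfolding nome_def exp_add[symmetric] by (simp add: algebra_simps)
  also have "exp (2 * of_int k * of_real pi * \<i>) = 1"
    using exp_integer_2pi[of "real_of_int k"] by simp
  finally show ?thesis by simp
qed

lemma Im_moebius_pos:
  assumes "a * d - b * c > (0 :: int)" "Im z > 0"
  shows "Im ((of_int a * z + of_int b) / (of_int c * z + of_int d)) > 0"
proof -
  have "Im ((of_int a * z + of_int b) * cnj (of_int c * z + of_int d)) = of_int (a * d - b * c) * Im z"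
    by (simp add: algebra_simps)
  also have "\<dots> > 0"
    using assms by (intro mult_pos_pos) (simp_all only: of_int_0_less_iff)
  finally show ?thesis
    by (simp only: Im_complex_div_gt_0)
qed

lemma linear_factor_nonzero:
  assumes "(c, d) \<noteq> (0, 0 :: int)" "Im z > 0"
  shows "of_int c * z + of_int d \<noteq> 0"
  using assms by (cases "c = 0") (auto simp: complex_eq_iff)

text \<open>A translation followed by the inversion replaces (a, b; c, d) by (-c, -d; a', b') with
  a' = a mod c, so the lower left entry shrinks in absolute value. At c = 0 only translations, up to
  sign, are left.\<close>

lemma E2_E4_modular:
  assumes "a * d - b * c = (1 :: int)" "Im z > 0"
  defines "j \<equiv> of_int c * z + of_int d"
  shows "E4 ((of_int a * z + of_int b) / j) = j ^ 4 * E4 z \<and>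
         E2 ((of_int a * z + of_int b) / j) = j ^ 2 * E2 z + 6 * of_int c * j / (of_real pi * \<i>)"
  using assms(1) unfolding j_def
proof (induction "nat \<bar>c\<bar>" arbitrary: a b c d rule: less_induct)
  case less
  show ?case
  proof (cases "c = 0")
    case True
    with less.prems have "a * d = 1" by simp
    then have "(a = 1 \<and> d = 1) \<or> (a = -1 \<and> d = -1)"
      by (auto simp: zmult_eq_1_iff)
    then have "(of_int a * z + of_int b) / (of_int c * z + of_int d) = z + of_int (b * d)"
        "(of_int c * z + of_int d) ^ 2 = (1 :: complex)" "(of_int c * z + of_int d) ^ 4 = (1 :: complex)"
      using True by (auto simp: field_simps)
    then show ?thesis
      using True by (simp only: E2_nome E4_nome nome_add_of_int) simp
  next
    case False
    define k where "k = - (a div c)"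
    define a' b' where "a' = a + k * c" and "b' = b + k * d"
    define j j' where "j = of_int c * z + of_int d" and "j' = of_int a' * z + of_int b'"
    define w where "w = (of_int a * z + of_int b) / j"
    have det: "a' * d - b' * c = 1"
      using less.prems by (simp add: a'_def b'_def algebra_simps)
    then have det': "(- c) * b' - (- d) * a' = 1" by (simp add: algebra_simps)
    have j0: "j \<noteq> 0" "j' \<noteq> 0"
      unfolding j_def j'_def using det False assms(2) by (intro linear_factor_nonzero; auto)+
    have w: "w + of_int k = j' / j"
      using j0 by (simp add: w_def j'_def j_def a'_def b'_def field_simps)
    have "Im (w + of_int k) > 0"
      using Im_moebius_pos[of a d b c z] less.prems assms(2) by (simp add: w_def j_def)
    note inversion = E4_minus_inverse[OF this] E2_minus_inverse[OF this]
    have "a' = a mod c" by (simp add: a'_def k_def minus_div_mult_eq_mod[symmetric])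
    then have "nat \<bar>a'\<bar> < nat \<bar>c\<bar>"
      using False abs_mod_less[of c a] by simp
    note IH = less.hyps[OF this det']
    have "- 1 / (w + of_int k) = (of_int (- c) * z + of_int (- d)) / j'"
      using j0 unfolding w by (simp add: j_def field_simps)
    then have "E4 (- 1 / (w + of_int k)) = j' ^ 4 * E4 z"
        "E2 (- 1 / (w + of_int k)) = j' ^ 2 * E2 z + 6 * of_int a' * j' / (of_real pi * \<i>)"
      using IH by (simp_all only: j'_def)
    moreover have "E4 (w + of_int k) = E4 w" "E2 (w + of_int k) = E2 w"
      by (simp_all add: E4_nome E2_nome nome_add_of_int)
    ultimately have eq: "j' ^ 4 * E4 z = (j' / j) ^ 4 * E4 w"
        "j' ^ 2 * E2 z + 6 * of_int a' * j' / (of_real pi * \<i>) = (j' / j) ^ 2 * E2 w + 6 * (j' / j) / (of_real pi * \<i>)"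
      using inversion by (simp_all only: w)
    have "E4 w = j ^ 4 * E4 z"
      using eq(1) j0 by (simp add: power_divide field_simps)
    moreover have "E2 w = j ^ 2 * E2 z + 6 * of_int c * j / (of_real pi * \<i>)"
    proof -
      \<comment> \<open>The determinant relation a' j - c j' = 1 is what makes the non-modular terms
        of \<open>E2\<close> compose.\<close>
      have cocycle: "of_int a' * j - 1 = of_int c * j'"
      proof -
        have "of_int a' * j - of_int (a' * d - b' * c) = of_int c * j'"
          by (simp add: j_def j'_def algebra_simps)
        then show ?thesis by (simp only: det of_int_1)
      qed
      have "6 * (of_int a' * j - 1) * (j' / j) / (of_real pi * \<i>)
          = 6 * of_int a' * j' / (of_real pi * \<i>) - 6 * (j' / j) / (of_real pi * \<i>)"
        using j0 by (simp add: left_diff_distrib right_diff_distrib diff_divide_distrib)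
      then have "(j' / j) ^ 2 * E2 w = j' ^ 2 * E2 z + 6 * (of_int a' * j - 1) * (j' / j) / (of_real pi * \<i>)"
        using eq(2) by (simp only: add_diff_eq add_diff_cancel_right')
      also have "\<dots> = (j' / j) ^ 2 * (j ^ 2 * E2 z + 6 * of_int c * j / (of_real pi * \<i>))"
        unfolding cocycle using j0 by (simp add: field_simps power2_eq_square)
      finally show ?thesis using j0 by simp
    qed
    ultimately show ?thesis by (simp only: w_def j_def)
  qed
qed

text \<open>With \<open>g = gcd c \<delta>\<close> and \<open>\<delta> = g D\<close>, the matrix \<open>(\<delta>a, \<delta>b; c, d)\<close> factors as an element of \<open>SL2Z\<close>
  times \<open>(g, B; 0, D)\<close>; the quasi-modular defect of \<open>E2\<close> cancels in \<open>L \<delta>\<close>.\<close>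

lemma E2_E4_dilate_modular:
  fixes a b c d :: int and \<delta> :: nat
  assumes det: "a * d - b * c = 1" and "\<delta> > 0"
  obtains D :: nat and B :: int where
    "int \<delta> = gcd c (int \<delta>) * int D" "D > 0"
    "\<And>z. Im z > 0 \<Longrightarrow>
       E4 (of_nat \<delta> * ((of_int a * z + of_int b) / (of_int c * z + of_int d)))
         = ((of_int c * z + of_int d) / of_nat D) ^ 4 * E4 ((of_int (gcd c (int \<delta>)) * z + of_int B) / of_nat D)"
    "\<And>z. Im z > 0 \<Longrightarrow>
       L \<delta> ((of_int a * z + of_int b) / (of_int c * z + of_int d))
         = (of_int c * z + of_int d) ^ 2 *
           (E2 z - of_nat \<delta> / of_nat D ^ 2 * E2 ((of_int (gcd c (int \<delta>)) * z + of_int B) / of_nat D))"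
proof -
  define g where "g = gcd c (int \<delta>)"
  have g: "g > 0" using assms(2) by (simp add: g_def)
  obtain c' where c': "c = g * c'" unfolding g_def by (meson dvdE gcd_dvd1)
  obtain D' where D': "int \<delta> = g * D'" unfolding g_def by (meson dvdE gcd_dvd2)
  have "D' > 0" using D' g assms(2) by (metis of_nat_0_less_iff zero_less_mult_pos)
  define D where "D = nat D'"
  have D: "int \<delta> = g * int D" "D > 0" using D' \<open>D' > 0\<close> by (auto simp: D_def)
  have "coprime c' (int D)"
  proof -
    have "g * gcd c' (int D) = gcd c (int \<delta>)"
      using g gcd_mult_distrib_int[of g c' "int D"] by (simp only: c'[symmetric] D(1))
    then show ?thesis using g by (simp add: g_def[symmetric] coprime_iff_gcd_eq_1)
  qed
  moreover have "coprime c' a"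
  proof (rule coprimeI)
    fix e assume "e dvd c'" "e dvd a"
    then have "e dvd a * d - b * c" by (auto simp: c')
    then show "is_unit e" by (simp add: det)
  qed
  ultimately have "coprime (int D * a) c'"
    by (simp add: coprime_commute)
  \<comment> \<open>The first column of diag(\<delta>, 1) \<gamma> is g times the primitive vector
    (Da, c'). Bezout completes that vector to a matrix (Da, x; c', y) of determinant 1.\<close>
  then obtain y x' where "y * (int D * a) + x' * c' = 1"
    using bezout_int[of "int D * a" c'] by (auto simp: coprime_iff_gcd_eq_1)
  define x where "x = - x'"
  have xy: "(int D * a) * y - x * c' = 1"
    using \<open>y * (int D * a) + x' * c' = 1\<close> by (simp add: x_def algebra_simps)
  \<comment> \<open>The upper right entry of the inverse of (Da, x; c', y) times diag(\<delta>, 1)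
    \<gamma>.\<close>
  define B where "B = y * (int \<delta> * b) - x * d"
  have B1: "int D * a * B + x * int D = int \<delta> * b"
  proof -
    have "int D * a * B + x * int D = (int D * a * y) * (int \<delta> * b) - x * int D * (a * d - 1)"
      by (simp add: B_def algebra_simps)
    also have "\<dots> = (int D * a * y) * (int \<delta> * b) - x * c' * (int \<delta> * b)"
    proof -
      have "a * d - 1 = b * c" using det by simp
      then show ?thesis by (simp only: c' D(1)) (simp add: algebra_simps)
    qed
    also have "\<dots> = ((int D * a) * y - x * c') * (int \<delta> * b)" by (simp add: algebra_simps)
    finally show ?thesis using xy by simp
  qed
  have B2: "c' * B + y * int D = d"
  proof -
    have "c' * B + y * int D = y * int D * (b * c + 1) - x * c' * d"
      by (simp only: B_def D(1) c') (simp add: algebra_simps)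
    also have "b * c + 1 = a * d" using det by simp
    also have "y * int D * (a * d) - x * c' * d = ((int D * a) * y - x * c') * d" by (simp add: algebra_simps)
    finally show ?thesis using xy by simp
  qed
  have main: "E4 (of_nat \<delta> * ((of_int a * z + of_int b) / j)) = (j / of_nat D) ^ 4 * E4 w \<and>
       L \<delta> ((of_int a * z + of_int b) / j) = j ^ 2 * (E2 z - of_nat \<delta> / of_nat D ^ 2 * E2 w)"
    if z: "Im z > 0" and j: "j = of_int c * z + of_int d" and w: "w = (of_int g * z + of_int B) / of_nat D" for z j w
  proof -
    have j0: "j \<noteq> 0" unfolding j using z det by (intro linear_factor_nonzero) auto
    have D0: "of_nat D \<noteq> (0 :: complex)" using D(2) by simp
    have "Im w > 0"
      using z g D(2) Im_moebius_pos[of g "int D" B 0 z] by (simp add: w)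
    note M = E2_E4_modular[OF xy this]
    have denom: "of_int c' * w + of_int y = j / of_nat D"
    proof -
      have "of_int c' * w + of_int y = (of_int (g * c') * z + of_int (c' * B + y * int D)) / of_nat D"
        using D0 by (simp add: w field_simps)
      then show ?thesis by (simp only: B2 c'[symmetric] j)
    qed
    have num: "of_int (int D * a) * w + of_int x = of_nat \<delta> * (of_int a * z + of_int b) / of_nat D"
    proof -
      have "of_int (int D * a) * w + of_int x = (of_int (g * int D) * of_int a * z + of_int (int D * a * B + x * int D)) / of_nat D"
        using D0 by (simp add: w field_simps)
      then show ?thesis by (simp only: B1 D(1)[symmetric]) (simp add: algebra_simps)
    qed
    have arg: "of_nat \<delta> * ((of_int a * z + of_int b) / j) = (of_int (int D * a) * w + of_int x) / (of_int c' * w + of_int y)"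
      unfolding denom num using j0 D0 by (simp add: field_simps)
    have E4: "E4 (of_nat \<delta> * ((of_int a * z + of_int b) / j)) = (j / of_nat D) ^ 4 * E4 w"
      unfolding arg using M denom by simp
    have E2: "E2 (of_nat \<delta> * ((of_int a * z + of_int b) / j)) = (j / of_nat D) ^ 2 * E2 w + 6 * of_int c' * (j / of_nat D) / (of_real pi * \<i>)"
      unfolding arg using M denom by simp
    have "of_nat \<delta> * (6 * of_int c' * (j / of_nat D) / (of_real pi * \<i>)) = 6 * of_int c * j / (of_real pi * \<i>)"
    proof -
      have "of_nat \<delta> = (of_int (int \<delta>) :: complex)" by simp
      also have "\<dots> = of_int g * of_nat D" by (simp only: D(1)) simp
      finally show ?thesis using D0 by (simp add: c' field_simps)
    qed
    then have "of_nat \<delta> * E2 (of_nat \<delta> * ((of_int a * z + of_int b) / j))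
        = of_nat \<delta> / of_nat D ^ 2 * j ^ 2 * E2 w + 6 * of_int c * j / (of_real pi * \<i>)"
      unfolding E2 distrib_left by (simp add: power_divide)
    moreover have "E2 ((of_int a * z + of_int b) / j) = j ^ 2 * E2 z + 6 * of_int c * j / (of_real pi * \<i>)"
      using E2_E4_modular[OF det z] by (simp add: j)
    ultimately show ?thesis
      using E4 by (simp add: L_def algebra_simps)
  qed
  show thesis
    by (rule that[of D B]) (use D main in \<open>auto simp: g_def\<close>)
qed

text \<open>Holding the expansion as a holomorphic function on the disc, with \<open>F 0\<close> as
  constant term, makes products and sums immediate, without Cauchy products. Taylor's theorem
  recovers the coefficients at the end.\<close>

definition fourier_with_constant :: "nat \<Rightarrow> (complex \<Rightarrow> complex) \<Rightarrow> complex \<Rightarrow> bool" where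
  "fourier_with_constant N f c \<longleftrightarrow>
     (\<exists>F. F holomorphic_on ball 0 1 \<and> F 0 = c \<and> (\<forall>z. Im z > 0 \<longrightarrow> f z = F (nome (z / of_nat N))))"

lemma fourier_with_constant_imp_expansion:
  assumes "fourier_with_constant N f c" "N > 0"
  shows "\<exists>a. has_fourier_expansion f N a \<and> a 0 = c"
proof -
  obtain F where F: "F holomorphic_on ball 0 1" "F 0 = c" "\<And>z. Im z > 0 \<Longrightarrow> f z = F (nome (z / of_nat N))"
    using assms(1) by (auto simp: fourier_with_constant_def)
  define a where "a n = (deriv ^^ n) F 0 / fact n" for n
  have "(\<lambda>n. a n * exp (2 * of_real pi * \<i> * z / of_nat N) ^ n) sums f z" if "z \<in> upper_half_plane" for z
  proof -
    have z: "Im z > 0" "Im (z / of_nat N) > 0" using that assms(2) by (auto simp: upper_half_plane_def)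
    have "nome (z / of_nat N) \<in> ball 0 1" using norm_nome_less_1[OF z(2)] by simp
    from holomorphic_power_series[OF F(1) this]
    show ?thesis using F(3)[OF z(1)] by (simp add: a_def nome_def)
  qed
  moreover have "a 0 = c" using F(2) by (simp add: a_def)
  ultimately show ?thesis unfolding has_fourier_expansion_def by blast
qed

lemma fourier_with_constant_mult:
  assumes "fourier_with_constant N f c" "fourier_with_constant N g d"
  shows "fourier_with_constant N (\<lambda>z. f z * g z) (c * d)"
proof -
  obtain F G where "F holomorphic_on ball 0 1" "F 0 = c" "\<And>z. Im z > 0 \<Longrightarrow> f z = F (nome (z / of_nat N))"
    "G holomorphic_on ball 0 1" "G 0 = d" "\<And>z. Im z > 0 \<Longrightarrow> g z = G (nome (z / of_nat N))"
    using assms by (auto simp: fourier_with_constant_def)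
  then show ?thesis
    unfolding fourier_with_constant_def
    by (intro exI[of _ "\<lambda>x. F x * G x"]) (auto intro!: holomorphic_intros)
qed

lemma fourier_with_constant_diff:
  assumes "fourier_with_constant N f c" "fourier_with_constant N g d"
  shows "fourier_with_constant N (\<lambda>z. f z - g z) (c - d)"
proof -
  obtain F G where "F holomorphic_on ball 0 1" "F 0 = c" "\<And>z. Im z > 0 \<Longrightarrow> f z = F (nome (z / of_nat N))"
    "G holomorphic_on ball 0 1" "G 0 = d" "\<And>z. Im z > 0 \<Longrightarrow> g z = G (nome (z / of_nat N))"
    using assms by (auto simp: fourier_with_constant_def)
  then show ?thesis
    unfolding fourier_with_constant_def
    by (intro exI[of _ "\<lambda>x. F x - G x"]) (auto intro!: holomorphic_intros)
qed

lemma fourier_with_constant_cmult: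
  assumes "fourier_with_constant N f c"
  shows "fourier_with_constant N (\<lambda>z. k * f z) (k * c)"
proof (rule fourier_with_constant_mult[OF _ assms])
  show "fourier_with_constant N (\<lambda>_. k) k"
    unfolding fourier_with_constant_def by (intro exI[of _ "\<lambda>_. k"]) auto
qed

lemma fourier_with_constant_sum:
  assumes "\<And>t. t \<in> T \<Longrightarrow> fourier_with_constant N (f t) (c t)"
  shows "fourier_with_constant N (\<lambda>z. \<Sum>t\<in>T. f t z) (\<Sum>t\<in>T. c t)"
proof -
  from assms obtain F where "\<And>t. t \<in> T \<Longrightarrow> F t holomorphic_on ball 0 1 \<and> F t 0 = c t \<and>
      (\<forall>z. Im z > 0 \<longrightarrow> f t z = F t (nome (z / of_nat N)))"
    unfolding fourier_with_constant_def by metis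
  then show ?thesis
    unfolding fourier_with_constant_def
    by (intro exI[of _ "\<lambda>x. \<Sum>t\<in>T. F t x"]) (auto intro!: holomorphic_intros)
qed

lemma fourier_with_constant_cong:
  assumes "fourier_with_constant N f c" "\<And>z. Im z > 0 \<Longrightarrow> f z = g z"
  shows "fourier_with_constant N g c"
  using assms unfolding fourier_with_constant_def by metis

lemma holomorphic_sigma_series: "sigma_series k holomorphic_on ball 0 1"
proof (rule power_series_holomorphic)
  fix x :: complex assume "x \<in> ball 0 1"
  then have "(\<lambda>n. of_nat (divisor_sigma k (Suc n)) * x ^ Suc n) sums sigma_series k x"
    by (intro has_sum_imp_sums sigma_series_has_sum) simp
  moreover have "divisor_sigma k 0 = 0" \<comment> \<open>a sum over the infinite set of divisors of 0\<close>
    by (simp add: divisor_sigma_def)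
  ultimately show "(\<lambda>n. of_nat (divisor_sigma k n) * (x - 0) ^ n) sums sigma_series k x"
    by (subst (asm) sums_Suc_iff) simp
qed

lemma sigma_series_0: "sigma_series k 0 = 0"
  by (simp add: sigma_series_def)

text \<open>With N = A D e one has A z / D = k z / N for k = A A e. So the inner nome is a root of
  unity times a positive power of the local parameter, and the constant term stays
  \<open>F 0\<close>.\<close>

lemma fourier_with_constant_compose_nome:
  assumes "F holomorphic_on ball 0 1" "A > 0" "D > 0" "N > 0" "A * D dvd N"
  shows "fourier_with_constant N (\<lambda>z. F (nome ((of_nat A * z + of_int B) / of_nat D))) (F 0)"
proof -
  obtain e where e: "N = A * D * e" using assms(5) by (elim dvdE)
  define k where "k = A * A * e"
  define \<zeta> where "\<zeta> = nome (of_int B / of_nat D)"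
  have k: "k > 0" using assms e by (auto simp: k_def)
  have \<zeta>: "norm \<zeta> = 1" by (simp add: \<zeta>_def norm_nome)
  have "nome ((of_nat A * z + of_int B) / of_nat D) = \<zeta> * nome (z / of_nat N) ^ k" for z
  proof -
    have "(of_nat A * z + of_int B) / of_nat D = of_int B / of_nat D + of_nat k * (z / of_nat N)"
      using assms e by (simp add: k_def field_simps)
    moreover have "nome (x + y) = nome x * nome y" for x y
      by (simp add: nome_def exp_add[symmetric] algebra_simps)
    ultimately show ?thesis by (simp only: \<zeta>_def nome_of_nat_mult)
  qed
  moreover have "(\<lambda>x. F (\<zeta> * x ^ k)) holomorphic_on ball 0 1"
  proof (rule holomorphic_on_compose_gen[unfolded o_def, OF _ assms(1)])
    show "(\<lambda>x. \<zeta> * x ^ k) ` ball 0 1 \<subseteq> ball 0 1"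
      using k \<zeta> by (auto simp: norm_mult norm_power power_less_one_iff)
  qed (intro holomorphic_intros)
  ultimately show ?thesis
    unfolding fourier_with_constant_def using k by (intro exI[of _ "\<lambda>x. F (\<zeta> * x ^ k)"]) (auto simp: zero_power)
qed

lemma fourier_E4:
  assumes "A > 0" "D > 0" "N > 0" "A * D dvd N"
  shows "fourier_with_constant N (\<lambda>z. E4 ((of_nat A * z + of_int B) / of_nat D)) 1"
proof -
  have "(\<lambda>x. 1 + 240 * sigma_series 3 x) holomorphic_on ball 0 1"
    by (intro holomorphic_intros holomorphic_sigma_series)
  from fourier_with_constant_compose_nome[OF this assms] show ?thesis
    by (simp add: E4_nome sigma_series_0)
qed

lemma fourier_E2:
  assumes "A > 0" "D > 0" "N > 0" "A * D dvd N"
  shows "fourier_with_constant N (\<lambda>z. E2 ((of_nat A * z + of_int B) / of_nat D)) 1"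
proof -
  have "(\<lambda>x. 1 - 24 * sigma_series 1 x) holomorphic_on ball 0 1"
    by (intro holomorphic_intros holomorphic_sigma_series)
  from fourier_with_constant_compose_nome[OF this assms] show ?thesis
    by (simp add: E2_nome sigma_series_0)
qed

section \<open>Constant terms at the cusps and invariance under \<open>Gamma0\<close>\<close>

lemma SL2Z_det: "\<gamma> \<in> SL2Z \<Longrightarrow> \<gamma> $ 1 $ 1 * \<gamma> $ 2 $ 2 - \<gamma> $ 1 $ 2 * \<gamma> $ 2 $ 1 = 1"
  by (simp add: SL2Z_def det_2)

text \<open>The automorphy factor cancels and leaves D^(-4) times \<open>E4\<close> at an upper
  triangular image of z, where 1/D = gcd / \<delta>.\<close>

lemma fourier_slash_E4:
  assumes "\<gamma> \<in> SL2Z" "\<delta> dvd N" "N > 0"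
  shows "fourier_with_constant N (slash 4 \<gamma> (\<lambda>z. E4 (of_nat \<delta> * z)))
           ((of_int (gcd (\<gamma> $ 2 $ 1) (int \<delta>)) / of_nat \<delta>) ^ 4)"
proof -
  define a b c d where "a = \<gamma> $ 1 $ 1" and "b = \<gamma> $ 1 $ 2" and "c = \<gamma> $ 2 $ 1" and "d = \<gamma> $ 2 $ 2"
  have det: "a * d - b * c = 1"
    using SL2Z_det[OF assms(1)] by (simp add: a_def b_def c_def d_def)
  have \<delta>: "\<delta> > 0" using assms by (auto intro: Nat.gr0I)
  obtain D B where DB: "int \<delta> = gcd c (int \<delta>) * int D" "D > 0"
    "\<And>z. Im z > 0 \<Longrightarrow>
       E4 (of_nat \<delta> * ((of_int a * z + of_int b) / (of_int c * z + of_int d)))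
         = ((of_int c * z + of_int d) / of_nat D) ^ 4 * E4 ((of_int (gcd c (int \<delta>)) * z + of_int B) / of_nat D)"
    using E2_E4_dilate_modular[OF det \<delta>] by metis
  define g where "g = nat (gcd c (int \<delta>))"
  have g: "gcd c (int \<delta>) = int g" "g > 0" using \<delta> by (simp_all add: g_def)
  have gD: "\<delta> = g * D" using DB(1) unfolding g by (metis of_nat_eq_iff of_nat_mult)
  have "fourier_with_constant N (\<lambda>z. (1 / of_nat D) ^ 4 * E4 ((of_nat g * z + of_int B) / of_nat D)) ((1 / of_nat D) ^ 4 * 1)"
    using assms gD g DB by (intro fourier_with_constant_cmult fourier_E4) auto
  then have "fourier_with_constant N (slash 4 \<gamma> (\<lambda>z. E4 (of_nat \<delta> * z))) ((1 / of_nat D) ^ 4 * 1)"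
  proof (rule fourier_with_constant_cong)
    fix z assume z: "Im z > 0"
    have "of_int c * z + of_int d \<noteq> 0"
      using det z by (intro linear_factor_nonzero) auto
    then show "(1 / of_nat D) ^ 4 * E4 ((of_nat g * z + of_int B) / of_nat D) = slash 4 \<gamma> (\<lambda>z. E4 (of_nat \<delta> * z)) z"
      unfolding slash_def a_def[symmetric] b_def[symmetric] c_def[symmetric] d_def[symmetric] DB(3)[OF z] g
      by (simp add: power_divide)
  qed
  moreover have "of_int (gcd c (int \<delta>)) / of_nat \<delta> = (1 / of_nat D :: complex)"
    unfolding g using g(2) by (simp add: gD)
  ultimately show ?thesis by (simp add: c_def)
qed

text \<open>As for \<open>E4\<close>, now with the factor \<delta> / D^2 = gcd^2 / \<delta> in front
  of the dilated \<open>E2\<close>.\<close>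

lemma fourier_slash_L:
  assumes "\<gamma> \<in> SL2Z" "\<delta> dvd N" "N > 0"
  shows "fourier_with_constant N (slash 2 \<gamma> (L \<delta>)) (1 - of_int (gcd (\<gamma> $ 2 $ 1) (int \<delta>)) ^ 2 / of_nat \<delta>)"
proof -
  define a b c d where "a = \<gamma> $ 1 $ 1" and "b = \<gamma> $ 1 $ 2" and "c = \<gamma> $ 2 $ 1" and "d = \<gamma> $ 2 $ 2"
  have det: "a * d - b * c = 1"
    using SL2Z_det[OF assms(1)] by (simp add: a_def b_def c_def d_def)
  have \<delta>: "\<delta> > 0" using assms by (auto intro: Nat.gr0I)
  obtain D B where DB: "int \<delta> = gcd c (int \<delta>) * int D" "D > 0"
    "\<And>z. Im z > 0 \<Longrightarrow>
       L \<delta> ((of_int a * z + of_int b) / (of_int c * z + of_int d))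
         = (of_int c * z + of_int d) ^ 2 *
           (E2 z - of_nat \<delta> / of_nat D ^ 2 * E2 ((of_int (gcd c (int \<delta>)) * z + of_int B) / of_nat D))"
    using E2_E4_dilate_modular[OF det \<delta>] by metis
  define g where "g = nat (gcd c (int \<delta>))"
  have g: "gcd c (int \<delta>) = int g" "g > 0" using \<delta> by (simp_all add: g_def)
  have gD: "\<delta> = g * D" using DB(1) unfolding g by (metis of_nat_eq_iff of_nat_mult)
  have "fourier_with_constant N E2 1"
    using fourier_E2[of 1 1 N 0] assms(3) by simp
  moreover have "fourier_with_constant N (\<lambda>z. of_nat \<delta> / of_nat D ^ 2 * E2 ((of_nat g * z + of_int B) / of_nat D)) (of_nat \<delta> / of_nat D ^ 2 * 1)"
    using assms gD g DB by (intro fourier_with_constant_cmult fourier_E2) auto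
  ultimately have "fourier_with_constant N (\<lambda>z. E2 z - of_nat \<delta> / of_nat D ^ 2 * E2 ((of_nat g * z + of_int B) / of_nat D))
      (1 - of_nat \<delta> / of_nat D ^ 2 * 1)"
    by (rule fourier_with_constant_diff)
  then have "fourier_with_constant N (slash 2 \<gamma> (L \<delta>)) (1 - of_nat \<delta> / of_nat D ^ 2 * 1)"
  proof (rule fourier_with_constant_cong)
    fix z assume z: "Im z > 0"
    have "of_int c * z + of_int d \<noteq> 0"
      using det z by (intro linear_factor_nonzero) auto
    then show "E2 z - of_nat \<delta> / of_nat D ^ 2 * E2 ((of_nat g * z + of_int B) / of_nat D) = slash 2 \<gamma> (L \<delta>) z"
      unfolding slash_def a_def[symmetric] b_def[symmetric] c_def[symmetric] d_def[symmetric] DB(3)[OF z] g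
      by simp
  qed
  moreover have "of_int (gcd c (int \<delta>)) ^ 2 / of_nat \<delta> = (of_nat \<delta> / of_nat D ^ 2 :: complex)"
    unfolding g using g(2) DB(2) by (simp add: gD field_simps power2_eq_square)
  ultimately show ?thesis by (simp add: c_def)
qed

text \<open>Here \<delta> divides c, so D = 1 and the triangular matrix is z -> \<delta> z + B,
  whose translation part the period absorbs.\<close>

lemma slash_Gamma0_invariant:
  assumes "\<gamma> \<in> Gamma0 N" "\<delta> dvd N" "N > 0" "Im z > 0"
  shows "slash 4 \<gamma> (\<lambda>z. E4 (of_nat \<delta> * z)) z = E4 (of_nat \<delta> * z)" "slash 2 \<gamma> (L \<delta>) z = L \<delta> z"
proof -
  define a b c d where "a = \<gamma> $ 1 $ 1" and "b = \<gamma> $ 1 $ 2" and "c = \<gamma> $ 2 $ 1" and "d = \<gamma> $ 2 $ 2"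
  have det: "a * d - b * c = 1"
    using SL2Z_det[of \<gamma>] assms(1) by (simp add: a_def b_def c_def d_def Gamma0_def)
  have \<delta>: "\<delta> > 0" using assms by (auto intro: Nat.gr0I)
  have "int \<delta> dvd c"
    using assms(1,2) by (auto simp: Gamma0_def c_def intro: dvd_trans)
  then have gcd: "gcd c (int \<delta>) = int \<delta>" by (simp add: gcd_proj2_iff)
  obtain D B where DB: "int \<delta> = gcd c (int \<delta>) * int D" "D > 0"
    "\<And>z. Im z > 0 \<Longrightarrow>
       E4 (of_nat \<delta> * ((of_int a * z + of_int b) / (of_int c * z + of_int d)))
         = ((of_int c * z + of_int d) / of_nat D) ^ 4 * E4 ((of_int (gcd c (int \<delta>)) * z + of_int B) / of_nat D)"
    "\<And>z. Im z > 0 \<Longrightarrow>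
       L \<delta> ((of_int a * z + of_int b) / (of_int c * z + of_int d))
         = (of_int c * z + of_int d) ^ 2 *
           (E2 z - of_nat \<delta> / of_nat D ^ 2 * E2 ((of_int (gcd c (int \<delta>)) * z + of_int B) / of_nat D))"
    using E2_E4_dilate_modular[OF det \<delta>] by metis
  have "D = 1" using DB(1) \<delta> unfolding gcd by simp
  have shift: "E4 (of_nat \<delta> * z + of_int B) = E4 (of_nat \<delta> * z)" "E2 (of_nat \<delta> * z + of_int B) = E2 (of_nat \<delta> * z)"
    by (simp_all add: E4_nome E2_nome nome_add_of_int)
  have "of_int c * z + of_int d \<noteq> 0"
    using det assms(4) by (intro linear_factor_nonzero) auto
  then show "slash 4 \<gamma> (\<lambda>z. E4 (of_nat \<delta> * z)) z = E4 (of_nat \<delta> * z)" "slash 2 \<gamma> (L \<delta>) z = L \<delta> z"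
    unfolding slash_def a_def[symmetric] b_def[symmetric] c_def[symmetric] d_def[symmetric] DB(3,4)[OF assms(4)] gcd
    using shift by (simp_all add: \<open>D = 1\<close> L_def)
qed

lemma holomorphic_E4_E2:
  assumes "\<delta> > 0"
  shows "(\<lambda>z. E4 (of_nat \<delta> * z)) holomorphic_on upper_half_plane"
    "(\<lambda>z. E2 (of_nat \<delta> * z)) holomorphic_on upper_half_plane"
proof -
  have "(\<lambda>z. sigma_series k (nome (of_nat \<delta> * z))) holomorphic_on upper_half_plane" for k
  proof (rule holomorphic_on_compose_gen[unfolded o_def, OF _ holomorphic_sigma_series])
    show "(\<lambda>z. nome (of_nat \<delta> * z)) holomorphic_on upper_half_plane"
      unfolding nome_def by (intro holomorphic_intros)
    show "(\<lambda>z. nome (of_nat \<delta> * z)) ` upper_half_plane \<subseteq> ball 0 1"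
      using assms by (auto simp: upper_half_plane_def norm_nome)
  qed
  then show "(\<lambda>z. E4 (of_nat \<delta> * z)) holomorphic_on upper_half_plane"
    "(\<lambda>z. E2 (of_nat \<delta> * z)) holomorphic_on upper_half_plane"
    unfolding E4_nome E2_nome by (auto intro!: holomorphic_intros)
qed

text \<open>The common frame for all three identities: \<kappa> holds the coefficients, and
  \<open>constants\<close> says that the constant terms cancel at every cusp, a condition on the
  lower left entry c alone.\<close>

lemma L_product_cusp_form:
  fixes N \<delta>\<^sub>1 \<delta>\<^sub>2 :: nat and T :: "nat set" and \<kappa> :: "nat \<Rightarrow> complex"
  assumes N: "N > 0" and dvd: "\<delta>\<^sub>1 dvd N" "\<delta>\<^sub>2 dvd N" "\<And>t. t \<in> T \<Longrightarrow> t dvd N"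
    and constants: "\<And>c. (1 - of_int (gcd c (int \<delta>\<^sub>1)) ^ 2 / of_nat \<delta>\<^sub>1) * (1 - of_int (gcd c (int \<delta>\<^sub>2)) ^ 2 / of_nat \<delta>\<^sub>2)
        = (\<Sum>t\<in>T. \<kappa> t * (of_int (gcd c (int t)) / of_nat t) ^ 4)"
  shows "(\<lambda>z. L \<delta>\<^sub>1 z * L \<delta>\<^sub>2 z - (\<Sum>t\<in>T. \<kappa> t * E4 (of_nat t * z))) \<in> cusp_forms 4 N"
    (is "?f \<in> _")
proof -
  have pos: "\<delta> > 0" if "\<delta> dvd N" for \<delta> using that N by (auto intro: Nat.gr0I)
  have slash: "slash 4 \<gamma> ?f z = slash 2 \<gamma> (L \<delta>\<^sub>1) z * slash 2 \<gamma> (L \<delta>\<^sub>2) z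
      - (\<Sum>t\<in>T. \<kappa> t * slash 4 \<gamma> (\<lambda>z. E4 (of_nat t * z)) z)" for \<gamma> z
    by (simp add: slash_def diff_divide_distrib sum_divide_distrib power2_eq_square power4_eq_xxxx)
  have holL: "L \<delta> holomorphic_on upper_half_plane" if "\<delta> dvd N" for \<delta>
    using holomorphic_E4_E2(2)[of 1] holomorphic_E4_E2(2)[OF pos[OF that]]
    unfolding L_def[abs_def] by (auto intro!: holomorphic_intros)
  have "?f holomorphic_on upper_half_plane"
    by (intro holomorphic_intros holL holomorphic_E4_E2 dvd pos)
  moreover have "slash 4 \<gamma> ?f z = ?f z" if "\<gamma> \<in> Gamma0 N" "z \<in> upper_half_plane" for \<gamma> z
  proof -
    have "Im z > 0" using that by (simp add: upper_half_plane_def)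
    note inv = slash_Gamma0_invariant[OF that(1) _ N this]
    show ?thesis
      unfolding slash by (simp add: inv dvd cong: sum.cong)
  qed
  moreover have "\<exists>a. has_fourier_expansion (slash 4 \<gamma> ?f) N a \<and> a 0 = 0" if "\<gamma> \<in> SL2Z" for \<gamma>
  proof (rule fourier_with_constant_imp_expansion[OF _ N])
    let ?c = "\<gamma> $ 2 $ 1"
    have "fourier_with_constant N (\<lambda>z. slash 2 \<gamma> (L \<delta>\<^sub>1) z * slash 2 \<gamma> (L \<delta>\<^sub>2) z
      - (\<Sum>t\<in>T. \<kappa> t * slash 4 \<gamma> (\<lambda>z. E4 (of_nat t * z)) z))
        ((1 - of_int (gcd ?c (int \<delta>\<^sub>1)) ^ 2 / of_nat \<delta>\<^sub>1) * (1 - of_int (gcd ?c (int \<delta>\<^sub>2)) ^ 2 / of_nat \<delta>\<^sub>2)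
        - (\<Sum>t\<in>T. \<kappa> t * (of_int (gcd ?c (int t)) / of_nat t) ^ 4))"
      by (intro fourier_with_constant_diff fourier_with_constant_mult fourier_with_constant_sum
          fourier_with_constant_cmult fourier_slash_L fourier_slash_E4 that N dvd)
    then show "fourier_with_constant N (slash 4 \<gamma> ?f) 0"
      unfolding constants by (simp add: slash[abs_def])
  qed
  ultimately show ?thesis
    by (simp add: cusp_forms_def)
qed

lemma gcd_prime_cases:
  assumes "prime p"
  shows "gcd c (int p) = 1 \<or> gcd c (int p) = int p"
proof -
  have "prime (int p)" using assms by simp
  moreover have "gcd c (int p) dvd int p" by simp
  ultimately show ?thesis
    by (metis gcd_ge_0_int prime_int_iff)
qed

lemma of_nat_sq_plus_1_nonzero: "(of_nat p :: complex) ^ 2 + 1 \<noteq> 0"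
proof -
  have "(of_nat p :: complex) ^ 2 + 1 = of_nat (p ^ 2 + 1)" by simp
  also have "\<dots> \<noteq> 0" by (subst of_nat_eq_0_iff) simp
  finally show ?thesis .
qed

section \<open>Cancellation of the constant terms\<close>

lemma L_square_prime:
  assumes "prime p"
  defines "P \<equiv> of_nat p :: complex"
  shows "\<exists>C \<in> cusp_forms 4 p. \<forall>z \<in> upper_half_plane.
     (L p z)^2 = (P - 1)^2 / (P^2 + 1) * E4 z + P^2 * (P - 1)^2 / (P^2 + 1) * E4 (P * z) + C z"
proof -
  define \<kappa> where "\<kappa> t = (if t = 1 then (P - 1)^2 / (P^2 + 1) else P^2 * (P - 1)^2 / (P^2 + 1))" for t :: nat
  have p: "p \<noteq> 1" "p > 0" using assms(1) prime_gt_1_nat[of p] by auto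
  have P: "P \<noteq> 0" "P ^ 2 + 1 \<noteq> 0" using p of_nat_sq_plus_1_nonzero[of p] by (simp_all add: P_def)
  have S: "(\<Sum>t\<in>{1, p}. f t) = f 1 + f p" for f :: "nat \<Rightarrow> complex" using p by simp
  have "(\<lambda>z. L p z * L p z - (\<Sum>t\<in>{1, p}. \<kappa> t * E4 (of_nat t * z))) \<in> cusp_forms 4 p"
  proof (rule L_product_cusp_form)
    fix c :: int
    \<comment> \<open>The gcds p and 1 give two linear equations for the coefficients k1, k2 in
      \<kappa>: (1 - p)^2 = k1 + k2 and (1 - 1/p)^2 = k1 + k2 / p^4.\<close>
    show "(1 - of_int (gcd c (int p)) ^ 2 / of_nat p) * (1 - of_int (gcd c (int p)) ^ 2 / of_nat p)
        = (\<Sum>t\<in>{1, p}. \<kappa> t * (of_int (gcd c (int t)) / of_nat t) ^ 4)"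
      using gcd_prime_cases[OF assms(1), of c] p P unfolding S \<kappa>_def P_def[symmetric]
      by (elim disjE; simp add: P_def[symmetric]; simp add: divide_simps; simp add: algebra_simps eval_nat_numeral)
  qed (use p in auto)
  then show ?thesis
    by (rule bexI[rotated]) (use p in \<open>simp add: S \<kappa>_def P_def power2_eq_square\<close>)
qed

text \<open>One divisibility is coprimality of the two gcds; for the other, the product of their
  Bezout representations is a combination of c and ab.\<close>

lemma gcd_mult_coprime_int:
  fixes a b c :: int
  assumes "coprime a b"
  shows "gcd c (a * b) = gcd c a * gcd c b"
proof (rule zdvd_antisym_nonneg)
  show "gcd c a * gcd c b dvd gcd c (a * b)"
  proof (rule gcd_greatest)
    have "coprime (gcd c a) (gcd c b)"
      using assms by (meson coprime_divisors gcd_dvd2)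
    then show "gcd c a * gcd c b dvd c"
      by (intro divides_mult) auto
  qed (intro mult_dvd_mono, auto)
  show "gcd c (a * b) dvd gcd c a * gcd c b"
  proof -
    obtain u v u' v' where "u * c + v * a = gcd c a" "u' * c + v' * b = gcd c b"
      using bezout_int by metis
    then have "gcd c a * gcd c b = (u * c + v * a) * (u' * c + v' * b)" by simp
    also have "\<dots> = c * (u * (u' * c + v' * b) + v * a * u') + v * v' * (a * b)"
      by (simp add: algebra_simps)
    also have "gcd c (a * b) dvd \<dots>"
      by (intro dvd_add dvd_mult dvd_mult2 gcd_dvd1 gcd_dvd2)
    finally show ?thesis .
  qed
qed auto

text \<open>The gcds enter \<open>constants\<close> only as complex numbers g and h with two
  possible values each, so each use reduces to four identities of rational functions in
  \<open>P\<close> and \<open>Q\<close>.\<close>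

lemma L_products_two_primes:
  assumes "prime p" "prime q" "p \<noteq> q"
  defines "P \<equiv> of_nat p :: complex" and "Q \<equiv> of_nat q :: complex"
  assumes "\<delta>\<^sub>1 dvd p * q" "\<delta>\<^sub>2 dvd p * q"
    and constants: "\<And>c g h. g = 1 \<or> g = P \<Longrightarrow> h = 1 \<or> h = Q \<Longrightarrow>
      of_int (gcd c (int p)) = g \<Longrightarrow> of_int (gcd c (int q)) = h \<Longrightarrow> of_int (gcd c (int (p * q))) = g * h \<Longrightarrow>
      (1 - of_int (gcd c (int \<delta>\<^sub>1)) ^ 2 / of_nat \<delta>\<^sub>1) * (1 - of_int (gcd c (int \<delta>\<^sub>2)) ^ 2 / of_nat \<delta>\<^sub>2)
        = k1 + k2 * (g / P) ^ 4 + k3 * (h / Q) ^ 4 + k4 * (g * h / (P * Q)) ^ 4"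
  shows "\<exists>C \<in> cusp_forms 4 (p * q). \<forall>z.
     L \<delta>\<^sub>1 z * L \<delta>\<^sub>2 z = k1 * E4 z + k2 * E4 (P * z) + k3 * E4 (Q * z) + k4 * E4 (P * Q * z) + C z"
proof -
  have pq: "p > 1" "q > 1" using assms(1,2) prime_gt_1_nat by auto
  then have neq: "p \<noteq> 1" "q \<noteq> 1" "p * q \<noteq> 1" "p * q \<noteq> p" "p * q \<noteq> q" "p \<noteq> q" "p > 0" "q > 0"
    using assms(3) by auto
  define \<kappa> where "\<kappa> t = (if t = 1 then k1 else if t = p then k2 else if t = q then k3 else k4)" for t :: nat
  have S: "(\<Sum>t\<in>{1, p, q, p * q}. f t) = f 1 + f p + f q + f (p * q)" for f :: "nat \<Rightarrow> complex"
  proof -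
    have "1 \<notin> {p, q, p * q}" "p \<notin> {q, p * q}" "q \<notin> {p * q}" using neq by auto
    then show ?thesis by (simp add: add_ac)
  qed
  have "(\<lambda>z. L \<delta>\<^sub>1 z * L \<delta>\<^sub>2 z - (\<Sum>t\<in>{1, p, q, p * q}. \<kappa> t * E4 (of_nat t * z))) \<in> cusp_forms 4 (p * q)"
  proof (rule L_product_cusp_form)
    fix c :: int
    have "gcd c (int (p * q)) = gcd c (int p) * gcd c (int q)"
      using gcd_mult_coprime_int[of "int p" "int q" c] primes_coprime[OF assms(1-3)] by simp
    then have gh: "(of_int (gcd c (int (p * q))) :: complex) = of_int (gcd c (int p)) * of_int (gcd c (int q))"
      by (simp only: of_int_mult)
    have "(of_int (gcd c (int p)) :: complex) = 1 \<or> (of_int (gcd c (int p)) :: complex) = P"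
      using gcd_prime_cases[OF assms(1), of c] by (auto simp: P_def)
    moreover have "(of_int (gcd c (int q)) :: complex) = 1 \<or> (of_int (gcd c (int q)) :: complex) = Q"
      using gcd_prime_cases[OF assms(2), of c] by (auto simp: Q_def)
    ultimately show "(1 - of_int (gcd c (int \<delta>\<^sub>1)) ^ 2 / of_nat \<delta>\<^sub>1) * (1 - of_int (gcd c (int \<delta>\<^sub>2)) ^ 2 / of_nat \<delta>\<^sub>2)
        = (\<Sum>t\<in>{1, p, q, p * q}. \<kappa> t * (of_int (gcd c (int t)) / of_nat t) ^ 4)"
      using constants[OF _ _ refl refl gh] gh neq unfolding S \<kappa>_def
      by (simp add: P_def Q_def)
  qed (use neq assms in auto)
  then show ?thesis
    by (rule bexI[rotated]) (use neq in \<open>simp add: S \<kappa>_def P_def Q_def\<close>)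
qed

theorem theorem2p1:
  shows "(\<forall>p::nat. prime p \<longrightarrow>
      (let P = (of_nat p :: complex) in
       \<exists>C \<in> cusp_forms 4 p. \<forall>z \<in> upper_half_plane.
         (L p z)^2 = (P - 1)^2 / (P^2 + 1) * E4 z
                   + P^2 * (P - 1)^2 / (P^2 + 1) * E4 (P * z)
                   + C z))
    \<and>
    (\<forall>p\<^sub>1 p\<^sub>2 :: nat. prime p\<^sub>1 \<and> prime p\<^sub>2 \<and> p\<^sub>1 \<noteq> p\<^sub>2 \<longrightarrow>
      (let P = (of_nat p\<^sub>1 :: complex); Q = (of_nat p\<^sub>2 :: complex) in
       \<exists>C \<in> cusp_forms 4 (p\<^sub>1 * p\<^sub>2). \<exists>C' \<in> cusp_forms 4 (p\<^sub>1 * p\<^sub>2).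
         (\<forall>z \<in> upper_half_plane.
           L p\<^sub>1 z * L p\<^sub>2 z =
               (P^2 - P + 1) * (Q^2 - Q + 1) / ((P^2 + 1) * (Q^2 + 1)) * E4 z
             - P^3 * (Q^2 - Q + 1) / ((P^2 + 1) * (Q^2 + 1)) * E4 (P * z)
             - Q^3 * (P^2 - P + 1) / ((P^2 + 1) * (Q^2 + 1)) * E4 (Q * z)
             + P^3 * Q^3 / ((P^2 + 1) * (Q^2 + 1)) * E4 (P * Q * z)
             + C z)
         \<and>
         (\<forall>z \<in> upper_half_plane.
           (L (p\<^sub>1 * p\<^sub>2) z)^2 =
               (1 - 2 * P * Q / ((P^2 + 1) * (Q^2 + 1))) * E4 z
             - 2 * P^3 * Q / ((P^2 + 1) * (Q^2 + 1)) * E4 (P * z)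
             - 2 * P * Q^3 / ((P^2 + 1) * (Q^2 + 1)) * E4 (Q * z)
             + (P^2 * Q^2 - 2 * P^3 * Q^3 / ((P^2 + 1) * (Q^2 + 1))) * E4 (P * Q * z)
             + C' z)))"
proof (intro conjI allI impI)
  fix p :: nat assume "prime p"
  then show "let P = (of_nat p :: complex) in
       \<exists>C \<in> cusp_forms 4 p. \<forall>z \<in> upper_half_plane.
         (L p z)^2 = (P - 1)^2 / (P^2 + 1) * E4 z
                   + P^2 * (P - 1)^2 / (P^2 + 1) * E4 (P * z)
                   + C z"
    unfolding Let_def by (rule L_square_prime)
next
  fix p q :: nat assume pq: "prime p \<and> prime q \<and> p \<noteq> q"
  then have prime: "prime p" "prime q" "p \<noteq> q" by auto
  define P Q where "P = (of_nat p :: complex)" and "Q = (of_nat q :: complex)"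
  have nz: "P \<noteq> 0" "Q \<noteq> 0" "P ^ 2 + 1 \<noteq> 0" "Q ^ 2 + 1 \<noteq> 0"
    using prime of_nat_sq_plus_1_nonzero by (auto simp: P_def Q_def dest: prime_gt_0_nat)
  obtain C where C: "C \<in> cusp_forms 4 (p * q)"
    "\<And>z. L p z * L q z = (P^2 - P + 1) * (Q^2 - Q + 1) / ((P^2 + 1) * (Q^2 + 1)) * E4 z
      + (- (P^3 * (Q^2 - Q + 1) / ((P^2 + 1) * (Q^2 + 1)))) * E4 (P * z)
      + (- (Q^3 * (P^2 - P + 1) / ((P^2 + 1) * (Q^2 + 1)))) * E4 (Q * z)
      + P^3 * Q^3 / ((P^2 + 1) * (Q^2 + 1)) * E4 (P * Q * z) + C z"
  proof -
    have "\<exists>C \<in> cusp_forms 4 (p * q). \<forall>z.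
      L p z * L q z = (P^2 - P + 1) * (Q^2 - Q + 1) / ((P^2 + 1) * (Q^2 + 1)) * E4 z
      + (- (P^3 * (Q^2 - Q + 1) / ((P^2 + 1) * (Q^2 + 1)))) * E4 (P * z)
      + (- (Q^3 * (P^2 - P + 1) / ((P^2 + 1) * (Q^2 + 1)))) * E4 (Q * z)
      + P^3 * Q^3 / ((P^2 + 1) * (Q^2 + 1)) * E4 (P * Q * z) + C z"
      unfolding P_def Q_def
    proof (rule L_products_two_primes[OF prime], unfold P_def[symmetric] Q_def[symmetric])
      fix c :: int and g h :: complex
      assume gh: "g = 1 \<or> g = P" "h = 1 \<or> h = Q"
        and c: "of_int (gcd c (int p)) = g" "of_int (gcd c (int q)) = h"
      \<comment> \<open>The right side factors: for g = 1 or P, 1 - g^2/P = (P^2 - P + 1)/(P^2 + 1)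
        - P^3/(P^2 + 1) (g/P)^4, and likewise for h and Q.\<close>
      show "(1 - of_int (gcd c (int p)) ^ 2 / P) * (1 - of_int (gcd c (int q)) ^ 2 / Q) =
        (P^2 - P + 1) * (Q^2 - Q + 1) / ((P^2 + 1) * (Q^2 + 1))
        + - (P^3 * (Q^2 - Q + 1) / ((P^2 + 1) * (Q^2 + 1))) * (g / P) ^ 4
        + - (Q^3 * (P^2 - P + 1) / ((P^2 + 1) * (Q^2 + 1))) * (h / Q) ^ 4
        + P^3 * Q^3 / ((P^2 + 1) * (Q^2 + 1)) * (g * h / (P * Q)) ^ 4"
        unfolding c using gh nz
        by (elim disjE; simp; simp add: divide_simps; simp add: algebra_simps eval_nat_numeral)
    qed auto
    then show thesis using that by blast
  qed
  obtain C' where C': "C' \<in> cusp_forms 4 (p * q)"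
    "\<And>z. L (p * q) z * L (p * q) z = (1 - 2 * P * Q / ((P^2 + 1) * (Q^2 + 1))) * E4 z
      + (- (2 * P^3 * Q / ((P^2 + 1) * (Q^2 + 1)))) * E4 (P * z)
      + (- (2 * P * Q^3 / ((P^2 + 1) * (Q^2 + 1)))) * E4 (Q * z)
      + (P^2 * Q^2 - 2 * P^3 * Q^3 / ((P^2 + 1) * (Q^2 + 1))) * E4 (P * Q * z) + C' z"
  proof -
    have "\<exists>C \<in> cusp_forms 4 (p * q). \<forall>z.
      L (p * q) z * L (p * q) z = (1 - 2 * P * Q / ((P^2 + 1) * (Q^2 + 1))) * E4 z
      + (- (2 * P^3 * Q / ((P^2 + 1) * (Q^2 + 1)))) * E4 (P * z)
      + (- (2 * P * Q^3 / ((P^2 + 1) * (Q^2 + 1)))) * E4 (Q * z)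
      + (P^2 * Q^2 - 2 * P^3 * Q^3 / ((P^2 + 1) * (Q^2 + 1))) * E4 (P * Q * z) + C z"
      unfolding P_def Q_def
    proof (rule L_products_two_primes[OF prime], unfold P_def[symmetric] Q_def[symmetric])
      fix c :: int and g h :: complex
      assume gh: "g = 1 \<or> g = P" "h = 1 \<or> h = Q"
        and c: "of_int (gcd c (int (p * q))) = g * h"
      have "(of_nat (p * q) :: complex) = P * Q" by (simp add: P_def Q_def)
      \<comment> \<open>The square is 1 - 2 (g^2/P)(h^2/Q) + P^2 Q^2 (gh/(PQ))^4; the middle term is
        rewritten by g^2/P = (P + P^3 (g/P)^4)/(P^2 + 1) and its analogue for h.\<close>
      then show "(1 - of_int (gcd c (int (p * q))) ^ 2 / of_nat (p * q)) * (1 - of_int (gcd c (int (p * q))) ^ 2 / of_nat (p * q)) =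
        (1 - 2 * P * Q / ((P^2 + 1) * (Q^2 + 1)))
        + - (2 * P^3 * Q / ((P^2 + 1) * (Q^2 + 1))) * (g / P) ^ 4
        + - (2 * P * Q^3 / ((P^2 + 1) * (Q^2 + 1))) * (h / Q) ^ 4
        + (P^2 * Q^2 - 2 * P^3 * Q^3 / ((P^2 + 1) * (Q^2 + 1))) * (g * h / (P * Q)) ^ 4"
        unfolding c using gh nz
        by (elim disjE; simp; simp add: divide_simps; simp add: algebra_simps eval_nat_numeral)
    qed auto
    then show thesis using that by blast
  qed
  show "let P = (of_nat p :: complex); Q = (of_nat q :: complex) in
       \<exists>C \<in> cusp_forms 4 (p * q). \<exists>C' \<in> cusp_forms 4 (p * q).
         (\<forall>z \<in> upper_half_plane.
           L p z * L q z =
               (P^2 - P + 1) * (Q^2 - Q + 1) / ((P^2 + 1) * (Q^2 + 1)) * E4 z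
             - P^3 * (Q^2 - Q + 1) / ((P^2 + 1) * (Q^2 + 1)) * E4 (P * z)
             - Q^3 * (P^2 - P + 1) / ((P^2 + 1) * (Q^2 + 1)) * E4 (Q * z)
             + P^3 * Q^3 / ((P^2 + 1) * (Q^2 + 1)) * E4 (P * Q * z)
             + C z)
         \<and>
         (\<forall>z \<in> upper_half_plane.
           (L (p * q) z)^2 =
               (1 - 2 * P * Q / ((P^2 + 1) * (Q^2 + 1))) * E4 z
             - 2 * P^3 * Q / ((P^2 + 1) * (Q^2 + 1)) * E4 (P * z)
             - 2 * P * Q^3 / ((P^2 + 1) * (Q^2 + 1)) * E4 (Q * z)
             + (P^2 * Q^2 - 2 * P^3 * Q^3 / ((P^2 + 1) * (Q^2 + 1))) * E4 (P * Q * z)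
             + C' z)"
    unfolding Let_def P_def[symmetric] Q_def[symmetric]
    by (rule bexI[OF _ C(1)], rule bexI[OF _ C'(1)])
       (simp only: power2_eq_square[of "L _ _"] C(2) C'(2) mult_minus_left diff_conv_add_uminus simp_thms Ball_def)
qed

end
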